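(* For every integer $k \geq 2$, every complex-representable matroid $M$ with rank $r(M) \geq 4(k-1)$ has an ordinary rank-$k$ flat.
   Context: A complex-representable matroid on a finite set $E$ is given by an assignment of a vector in $\mathbb{C}^{n}$ (for some $n$) to each element of $E$; a subset $X \subseteq E$ is independent if the associated family of vectors is linearly independent. The rank $r(X)$ of $X \subseteq E$ is the maximum size of an independent subset of $X$, and $r(M) = r(E)$. A rank-$k$ flat is an inclusion-wise maximal subset of $E$ of rank $k$; a point is a rank-$1$ flat. A flat $F$ is the direct sum of flats $F_1$ and $F_2$ if $F = F_1 \cup F_2$ and $r(F) = r(F_1) + r(F_2)$. A rank-$k$ flat is called ordinary if it is the direct sum of a point and a rank-$(k-1)$ flat. *)

theory Defs
  imports "HOL-Analysis.Analysis"
begin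

text \<open>
  The matroid on \<open>E\<close> represented by \<open>v\<close> is given by its independence predicate. Linear
  independence is that of the indexed family \<open>(v x)\<close> for \<open>x \<in> X\<close>, hence the injectivity
  condition; loops (\<open>v x = 0\<close>) and parallel elements are allowed. Here \<open>vec.independent\<close> is
  independence over \<open>complex\<close>, whereas plain \<open>independent\<close> would be over \<open>real\<close>.
\<close>

definition complex_indep :: "'a set \<Rightarrow> ('a \<Rightarrow> complex ^ 'n) \<Rightarrow> 'a set \<Rightarrow> bool" where
  "complex_indep E v X \<longleftrightarrow> X \<subseteq> E \<and> inj_on v X \<and> vec.independent (v ` X)"

definition matroid_rank :: "('a set \<Rightarrow> bool) \<Rightarrow> 'a set \<Rightarrow> nat" where
  "matroid_rank indep X = Max {card I | I. I \<subseteq> X \<and> indep I}"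

definition rank_flat :: "'a set \<Rightarrow> ('a set \<Rightarrow> bool) \<Rightarrow> nat \<Rightarrow> 'a set \<Rightarrow> bool" where
  "rank_flat E indep k F \<longleftrightarrow>
     F \<subseteq> E \<and> matroid_rank indep F = k \<and>
     (\<forall>G. F \<subseteq> G \<and> G \<subseteq> E \<and> matroid_rank indep G = k \<longrightarrow> G = F)"

definition matroid_point :: "'a set \<Rightarrow> ('a set \<Rightarrow> bool) \<Rightarrow> 'a set \<Rightarrow> bool" where
  "matroid_point E indep P \<longleftrightarrow> rank_flat E indep 1 P"

definition flat_direct_sum :: "('a set \<Rightarrow> bool) \<Rightarrow> 'a set \<Rightarrow> 'a set \<Rightarrow> 'a set \<Rightarrow> bool" where
  "flat_direct_sum indep F F1 F2 \<longleftrightarrow>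
     F = F1 \<union> F2 \<and> matroid_rank indep F = matroid_rank indep F1 + matroid_rank indep F2"

text \<open>Intended for \<open>k \<ge> 1\<close>, because of the truncated subtraction \<open>k - 1\<close>.\<close>

definition ordinary_flat :: "'a set \<Rightarrow> ('a set \<Rightarrow> bool) \<Rightarrow> nat \<Rightarrow> 'a set \<Rightarrow> bool" where
  "ordinary_flat E indep k F \<longleftrightarrow>
     rank_flat E indep k F \<and>
     (\<exists>P H. matroid_point E indep P \<and> rank_flat E indep (k - 1) H \<and>
            flat_direct_sum indep F P H)"

end

theory Submission
  imports Defs
begin

text \<open>
  The analytic core is a rank bound in the style of Dvir, Saraf and Wigderson: if each of \<open>n\<close>
  points spans a line with at least three points together with at least \<open>\<beta>\<close> of the others, then
  the rank \<open>D\<close> satisfies \<open>D (\<beta> + 4) \<le> 4 n\<close>. Each collinear triple gives a linear relation;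
  weight the triples so that every pair on such a line has total weight one. Rescaling the vectors
  and the relations (a minimum of a convex potential) makes the matrix \<open>M = a\<^sup>* a\<close> of relations have
  unit diagonal and off-diagonal Frobenius norm squared at most \<open>4 n / \<beta>\<close>. The kernel of \<open>M\<close> has
  dimension at least \<open>D\<close>, and comparing \<open>M\<close> with the orthogonal projection onto a
  \<open>D\<close>-dimensional part of the kernel gives the bound.

  Put \<open>K = k - 1\<close> and suppose there is no ordinary rank-\<open>k\<close> flat. For a flat \<open>A\<close> of rank \<open>j\<close> let \<open>N\<close>
  be the number of points outside \<open>A\<close> and \<open>s\<close> the number of points \<open>x\<close> for which \<open>A \<union> {x}\<close> is a flat.
  Downward induction on \<open>j\<close> shows \<open>K s \<le> (K - j) N\<close>, strictly for \<open>j < K\<close>. If this failed for \<open>A\<close>,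
  then by the bound for the rank \<open>j + 1\<close> flats containing \<open>A\<close>, every point of the contraction by
  \<open>A\<close> lies on lines of at least three points with at least \<open>s - 1 - (K - j - 1) (N - 1) / K\<close> others,
  whereas the contraction has at most \<open>(N + s) / 2\<close> points and rank at least \<open>4 K - j\<close>,
  contradicting the rank bound. For \<open>j = 0\<close> one has \<open>s = N\<close>, which is absurd.
\<close>

section \<open>Scaling weighted triples\<close>

text \<open>
  The potential is convex, and its stationarity condition says that the weights
  \<open>w t * c t i * exp (x i)\<close>, normalised to total \<open>w t\<close> on each triple \<open>t\<close>, give every \<open>i\<close> the
  total a third of the weight of the triples through it.
\<close>

definition triple_potential ::
  "'b set set \<Rightarrow> ('b set \<Rightarrow> real) \<Rightarrow> ('b set \<Rightarrow> 'b \<Rightarrow> real) \<Rightarrow> ('b \<Rightarrow> real) \<Rightarrow> real" where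
  "triple_potential T w c x =
     (\<Sum>t\<in>T. w t * (ln (\<Sum>i\<in>t. c t i * exp (x i)) - (\<Sum>i\<in>t. x i) / 3))"

text \<open>Coercivity of a single term of the potential. With \<open>m\<close> the largest
  coordinate, the sum is at least \<open>c0 * exp m\<close>, and \<open>3 * m\<close> minus the sum
  of the coordinates is a sum of nonnegative terms \<open>m - x l\<close>, one of which is
  \<open>m - x j\<close>.\<close>

lemma log_sum_exp_minus_mean_lower:
  fixes x c :: "'b \<Rightarrow> real"
  assumes t: "card t = 3" and c: "\<And>l. l \<in> t \<Longrightarrow> c l \<ge> c0" "c0 > 0"
    and ij: "i \<in> t" "j \<in> t"
  shows "ln (\<Sum>l\<in>t. c l * exp (x l)) - (\<Sum>l\<in>t. x l) / 3 \<ge> ln c0 + (x i - x j) / 3"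
proof -
  have fin: "finite t" using t by (simp add: card_ge_0_finite)
  define m where "m = Max (x ` t)"
  have m_ge: "x l \<le> m" if "l \<in> t" for l
    using that fin by (simp add: m_def)
  have "m \<in> x ` t" unfolding m_def using fin ij by (intro Max_in) auto
  then obtain k where k: "k \<in> t" "x k = m" by auto
  have "c0 * exp m \<le> c k * exp (x k)" using k c by simp
  also have "\<dots> \<le> (\<Sum>l\<in>t. c l * exp (x l))"
    using fin k c by (intro member_le_sum) (auto intro!: mult_nonneg_nonneg less_imp_le[OF less_le_trans[OF c(2) c(1)]])
  finally have "ln (c0 * exp m) \<le> ln (\<Sum>l\<in>t. c l * exp (x l))"
    using c(2) by (intro ln_mono) auto
  then have 1: "ln c0 + m \<le> ln (\<Sum>l\<in>t. c l * exp (x l))"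
    using c(2) by (simp add: ln_mult)
  have "(m - x j) \<le> (\<Sum>l\<in>t. m - x l)"
    using fin ij m_ge by (intro member_le_sum[where f = "\<lambda>l. m - x l"]) auto
  also have "\<dots> = 3 * m - (\<Sum>l\<in>t. x l)" using t by (simp add: sum_subtractf)
  finally show ?thesis using 1 m_ge[OF ij(1)] by (simp add: field_simps)
qed

text \<open>Subtracting \<open>s t\<close> from the coordinates of \<open>t\<close> lowers both the
  logarithm and the mean by \<open>s t\<close>. The amount may vary with the triple, which allows a
  separate normalisation on each connected component.\<close>

lemma triple_potential_shift:
  assumes T: "\<And>t. t \<in> T \<Longrightarrow> card t = 3" and c: "\<And>t i. t \<in> T \<Longrightarrow> i \<in> t \<Longrightarrow> c t i > 0"
    and shift: "\<And>t i. t \<in> T \<Longrightarrow> i \<in> t \<Longrightarrow> y i = x i - s t"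
  shows "triple_potential T w c y = triple_potential T w c x"
  unfolding triple_potential_def
proof (intro sum.cong refl arg_cong[where f = "\<lambda>z. w _ * z"])
  fix t assume t: "t \<in> T"
  have fin: "finite t" "t \<noteq> {}" using T[OF t] by (auto simp: card_ge_0_finite)
  have pos: "(\<Sum>i\<in>t. c t i * exp (x i)) > 0"
    using fin c[OF t] by (intro sum_pos) auto
  have "(\<Sum>i\<in>t. c t i * exp (y i)) = (\<Sum>i\<in>t. c t i * exp (x i)) * exp (- s t)"
    unfolding sum_distrib_right
    by (intro sum.cong refl) (simp add: shift[OF t] exp_diff exp_minus divide_inverse)
  then have 1: "ln (\<Sum>i\<in>t. c t i * exp (y i)) = ln (\<Sum>i\<in>t. c t i * exp (x i)) - s t"
    using pos by (simp add: ln_mult)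
  have "(\<Sum>i\<in>t. y i) = (\<Sum>i\<in>t. x i) - 3 * s t"
    using shift[OF t] T[OF t] by (simp add: sum_subtractf)
  with 1 show "ln (\<Sum>i\<in>t. c t i * exp (y i)) - (\<Sum>i\<in>t. y i) / 3 =
      ln (\<Sum>i\<in>t. c t i * exp (x i)) - (\<Sum>i\<in>t. x i) / 3"
    by (simp add: field_simps)
qed

lemma continuous_on_triple_potential:
  assumes T: "\<And>t. t \<in> T \<Longrightarrow> card t = 3" and c: "\<And>t i. t \<in> T \<Longrightarrow> i \<in> t \<Longrightarrow> c t i > 0"
  shows "continuous_on UNIV (triple_potential T w c)"
proof -
  have "(\<Sum>i\<in>t. c t i * exp (x i)) \<noteq> 0" if "t \<in> T" for t and x :: "'a \<Rightarrow> real"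
  proof -
    have "finite t" "t \<noteq> {}" using T[OF that] by (auto simp: card_ge_0_finite)
    then have "(\<Sum>i\<in>t. c t i * exp (x i)) > 0" using c[OF that] by (intro sum_pos) auto
    then show ?thesis by simp
  qed
  then show ?thesis
    unfolding triple_potential_def by (intro continuous_intros) auto
qed

text \<open>A bound on the potential bounds coordinate differences within a triple, hence along
  chains of overlapping triples. After normalisation this leaves a continuous function on a compact
  box.\<close>

lemma triple_potential_has_minimum:
  fixes X :: "'b set"
  assumes X: "finite X" and T: "finite T" "\<And>t. t \<in> T \<Longrightarrow> t \<subseteq> X \<and> card t = 3"
    and w: "\<And>t. t \<in> T \<Longrightarrow> w t > 0"
    and c: "\<And>t i. t \<in> T \<Longrightarrow> i \<in> t \<Longrightarrow> c t i > 0"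
  shows "\<exists>x. \<forall>y. triple_potential T w c x \<le> triple_potential T w c y"
proof -
  let ?f = "triple_potential T w c"
  let ?z = "\<lambda>_::'b. 0::real"
  define R where "R = {(i, j). \<exists>t\<in>T. i \<in> t \<and> j \<in> t}"
  have fin_t: "finite t" if "t \<in> T" for t using T(2)[OF that] X finite_subset by auto
  \<comment> \<open>Inserting \<open>1\<close> keeps the set nonempty even when \<open>T\<close> is
    empty.\<close>
  define c0 where "c0 = Min (insert 1 (\<Union>t\<in>T. c t ` t))"
  have finC: "finite (insert 1 (\<Union>t\<in>T. c t ` t))" using T fin_t by auto
  have c0: "c0 > 0" "\<And>t i. t \<in> T \<Longrightarrow> i \<in> t \<Longrightarrow> c0 \<le> c t i"
    using finC c by (auto simp: c0_def intro!: Min_le)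
  \<comment> \<open>The term of any other triple \<open>s\<close> is at least
    \<open>w s * ln c0\<close>, so a bound on the whole potential bounds the term of
    \<open>t\<close> from above.\<close>
  have edge: "\<exists>B. \<forall>x. ?f x \<le> ?f ?z \<longrightarrow> \<bar>x i - x j\<bar> \<le> B" if "(i, j) \<in> R" for i j
  proof -
    from that obtain t where t: "t \<in> T" "i \<in> t" "j \<in> t" by (auto simp: R_def)
    have "x a - x b \<le> 3 * ((?f ?z - (\<Sum>s\<in>T - {t}. w s * ln c0)) / w t - ln c0)"
      if le: "?f x \<le> ?f ?z" and ab: "a \<in> t" "b \<in> t" for x a b
    proof -
      have "w t * (ln c0 + (x a - x b) / 3) + (\<Sum>s\<in>T - {t}. w s * ln c0) \<le> ?f x"
      proof -
        have "(\<Sum>s\<in>T - {t}. w s * ln c0) \<le> (\<Sum>s\<in>T - {t}. w s * (ln (\<Sum>i\<in>s. c s i * exp (x i)) - (\<Sum>i\<in>s. x i) / 3))"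
        proof (intro sum_mono mult_left_mono)
          fix s assume s: "s \<in> T - {t}"
          then obtain k where "k \<in> s" using T(2)[of s] by (metis DiffD1 card.empty equals0I zero_neq_numeral)
          then show "ln c0 \<le> ln (\<Sum>i\<in>s. c s i * exp (x i)) - (\<Sum>i\<in>s. x i) / 3"
            using log_sum_exp_minus_mean_lower[of s c0 "c s" k k x] T(2) c0 s by auto
        qed (use w in \<open>auto intro: less_imp_le\<close>)
        moreover have "w t * (ln c0 + (x a - x b) / 3) \<le> w t * (ln (\<Sum>i\<in>t. c t i * exp (x i)) - (\<Sum>i\<in>t. x i) / 3)"
          using log_sum_exp_minus_mean_lower[of t c0 "c t" a b x] T(2) c0 t ab w
          by (intro mult_left_mono) (auto intro: less_imp_le)
        ultimately show ?thesis
          unfolding triple_potential_def using t T(1) by (subst (2) sum.remove[of _ t]) auto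
      qed
      with le have "w t * (ln c0 + (x a - x b) / 3) \<le> ?f ?z - (\<Sum>s\<in>T - {t}. w s * ln c0)" by linarith
      then have "ln c0 + (x a - x b) / 3 \<le> (?f ?z - (\<Sum>s\<in>T - {t}. w s * ln c0)) / w t"
        using w[OF t(1)] by (simp add: pos_le_divide_eq mult.commute)
      have arith: "d \<le> 3 * (Q - l)" if "l + d / 3 \<le> Q" for d l Q :: real
        using that by simp
      show ?thesis by (rule arith) fact
    qed
    note bound = this
    show ?thesis
    proof (intro exI allI impI)
      fix x assume "?f x \<le> ?f ?z"
      from bound[OF this t(2,3)] bound[OF this t(3,2)]
      show "\<bar>x i - x j\<bar> \<le> 3 * ((?f ?z - (\<Sum>s\<in>T - {t}. w s * ln c0)) / w t - ln c0)"
        by (simp only: abs_le_iff minus_diff_eq)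
    qed
  qed
  have path: "\<exists>B. \<forall>x. ?f x \<le> ?f ?z \<longrightarrow> \<bar>x i - x j\<bar> \<le> B" if "(i, j) \<in> R\<^sup>*" for i j
    using that
  proof (induction rule: rtrancl_induct)
    case base
    then show ?case by (intro exI[of _ 0]) auto
  next
    case (step j k)
    obtain B where B: "\<And>x. ?f x \<le> ?f ?z \<Longrightarrow> \<bar>x i - x j\<bar> \<le> B" using step.IH by blast
    obtain B' where B': "\<And>x. ?f x \<le> ?f ?z \<Longrightarrow> \<bar>x j - x k\<bar> \<le> B'" using edge[OF step.hyps(2)] by blast
    have "\<bar>x i - x k\<bar> \<le> B + B'" if "?f x \<le> ?f ?z" for x
      using B[OF that] B'[OF that] by linarith
    then show ?case by blast
  qed
  \<comment> \<open>The potential is invariant under adding a constant on each connected component of \<open>R\<close>, so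
    the search for a minimum can be confined to a box by vanishing at component representatives.\<close>
  define rep where "rep i = (SOME j. (i, j) \<in> R\<^sup>*)" for i
  have rep: "(i, rep i) \<in> R\<^sup>*" for i
    unfolding rep_def by (rule someI[of _ i]) simp
  have rep_eq: "rep i = rep j" if "t \<in> T" "i \<in> t" "j \<in> t" for t i j
  proof -
    have "(i, j) \<in> R" "(j, i) \<in> R" using that by (auto simp: R_def)
    then have "(i, k) \<in> R\<^sup>* \<longleftrightarrow> (j, k) \<in> R\<^sup>*" for k
      by (meson converse_rtrancl_into_rtrancl)
    then show ?thesis by (simp add: rep_def)
  qed
  have "\<forall>i. \<exists>B. \<forall>x. ?f x \<le> ?f ?z \<longrightarrow> \<bar>x i - x (rep i)\<bar> \<le> B" using path rep by blast
  then obtain B0 where B0: "\<And>i x. ?f x \<le> ?f ?z \<Longrightarrow> \<bar>x i - x (rep i)\<bar> \<le> B0 i" by metis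
  define B where "B = (\<Sum>i\<in>X. \<bar>B0 i\<bar>)"
  have B: "\<bar>x i - x (rep i)\<bar> \<le> B" if "?f x \<le> ?f ?z" "i \<in> X" for x i
  proof -
    have "\<bar>x i - x (rep i)\<bar> \<le> \<bar>B0 i\<bar>" using B0[OF that(1), of i] by linarith
    also have "\<dots> \<le> B" unfolding B_def using X that by (intro member_le_sum[where f = "\<lambda>i. \<bar>B0 i\<bar>"]) auto
    finally show ?thesis .
  qed
  have B_nonneg: "B \<ge> 0" by (simp add: B_def sum_nonneg)
  \<comment> \<open>Coordinates outside \<open>X\<close> occur in no triple and are pinned to
    \<open>0\<close>. The box is a product of compact sets, hence compact by Tychonoff even over an
    infinite type.\<close>
  define K where "K = (PiE UNIV (\<lambda>i. if i \<in> X then {-B..B} else {0::real}))"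
  have "compactin (product_topology (\<lambda>i::'b. euclidean) UNIV) K"
    unfolding K_def compactin_PiE by auto
  then have "compact K" by (simp add: euclidean_product_topology)
  moreover have zK: "?z \<in> K" using B_nonneg by (auto simp: K_def)
  moreover have "continuous_on K ?f"
    using continuous_on_triple_potential[of T c w] T(2) c by (auto intro: continuous_on_subset)
  ultimately obtain x where x: "x \<in> K" "\<And>y. y \<in> K \<Longrightarrow> ?f x \<le> ?f y"
    using continuous_attains_inf[of K ?f] by blast
  have "?f x \<le> ?f y" for y
  proof (cases "?f y \<le> ?f ?z")
    case False
    then show ?thesis using x(2)[OF zK] by simp
  next
    case True
    define y' where "y' i = (if i \<in> X then y i - y (rep i) else 0)" for i
    have "y' \<in> K" using B[OF True] by (auto simp: K_def y'_def abs_le_iff) (metis minus_diff_eq neg_le_iff_le)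
    moreover have "?f y' = ?f y"
    proof (rule triple_potential_shift[where s = "\<lambda>t. y (rep (SOME i. i \<in> t))"])
      fix t i assume ti: "t \<in> T" "i \<in> t"
      then have "rep (SOME i. i \<in> t) = rep i" by (intro rep_eq[of t]) (auto intro: someI)
      then show "y' i = y i - y (rep (SOME i. i \<in> t))" using ti T(2) by (auto simp: y'_def)
    qed (use T c in auto)
    ultimately show ?thesis using x(2) by metis
  qed
  then show ?thesis by blast
qed

text \<open>At a minimum all partial derivatives of the potential vanish, and the one in coordinate
  \<open>i\<close> is the difference of the two sides.\<close>

lemma triple_scaling_exists:
  fixes X :: "'b set"
  assumes X: "finite X" and T: "finite T" "\<And>t. t \<in> T \<Longrightarrow> t \<subseteq> X \<and> card t = 3"
    and w: "\<And>t. t \<in> T \<Longrightarrow> w t > 0"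
    and c: "\<And>t i. t \<in> T \<Longrightarrow> i \<in> t \<Longrightarrow> c t i > 0"
  shows "\<exists>x :: 'b \<Rightarrow> real. \<forall>i.
    (\<Sum>t | t \<in> T \<and> i \<in> t. w t * (c t i * exp (x i) / (\<Sum>l\<in>t. c t l * exp (x l)))) =
    (\<Sum>t | t \<in> T \<and> i \<in> t. w t) / 3"
proof -
  have "\<exists>x. \<forall>y. triple_potential T w c x \<le> triple_potential T w c y"
    by (rule triple_potential_has_minimum[of X]) (fact assms)+
  then obtain x where x: "\<And>y. triple_potential T w c x \<le> triple_potential T w c y"
    by blast
  show ?thesis
  proof (intro exI[of _ x] allI)
    fix i
    define h where "h s = triple_potential T w c (\<lambda>l. x l + (if l = i then s else 0))" for s
    have min: "h 0 \<le> h s" for s using x by (simp add: h_def)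
    define Z where "Z t = (\<Sum>l\<in>t. c t l * exp (x l))" for t
    have Z: "Z t > 0" if "t \<in> T" for t
    proof -
      have "finite t" "t \<noteq> {}" using T(2)[OF that] by (auto simp: card_ge_0_finite)
      then show ?thesis unfolding Z_def using c[OF that] by (intro sum_pos) auto
    qed
    have "(h has_real_derivative (\<Sum>t\<in>T. w t *
        ((\<Sum>l\<in>t. c t l * (exp (x l) * (if l = i then 1 else 0))) / Z t -
         (\<Sum>l\<in>t. (if l = i then 1 else 0)) / 3))) (at 0)"
    proof -
      have d: "((\<lambda>s. if l = i then s else 0) has_real_derivative (if l = i then 1 else 0)) (at 0)" for l
        by (cases "l = i") (auto intro!: derivative_eq_intros)
      have Z': "0 < (\<Sum>l\<in>t. exp (x l) * c t l)" if "t \<in> T" for t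
        using Z[OF that] by (simp add: Z_def mult.commute)
      show ?thesis
        unfolding h_def triple_potential_def
        by (auto intro!: derivative_eq_intros d sum.cong simp: Z_def Z' mult_ac)
    qed
    then have "(\<Sum>t\<in>T. w t *
        ((\<Sum>l\<in>t. c t l * (exp (x l) * (if l = i then 1 else 0))) / Z t -
         (\<Sum>l\<in>t. (if l = i then 1 else 0)) / 3)) = 0"
      by (rule DERIV_local_min[of _ _ _ 1]) (use min in auto)
    also have "(\<Sum>t\<in>T. w t *
        ((\<Sum>l\<in>t. c t l * (exp (x l) * (if l = i then 1 else 0))) / Z t -
         (\<Sum>l\<in>t. (if l = i then 1 else 0)) / 3)) =
        (\<Sum>t\<in>T. if i \<in> t then w t * (c t i * exp (x i) / Z t) - w t / 3 else 0)"
    proof (intro sum.cong refl)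
      fix t assume t: "t \<in> T"
      have fin: "finite t" using T(2)[OF t] X finite_subset by auto
      have "(\<Sum>l\<in>t. c t l * (exp (x l) * (if l = i then 1 else 0))) = (if i \<in> t then c t i * exp (x i) else 0)"
        using sum.delta[OF fin, of i "\<lambda>l. c t l * exp (x l)"] by (simp add: if_distrib cong: if_cong)
      moreover have "(\<Sum>l\<in>t. (if l = i then 1 else 0)) = (if i \<in> t then 1 else (0::real))"
        using sum.delta[OF fin, of i "\<lambda>l. 1::real"] by simp
      ultimately show "w t * ((\<Sum>l\<in>t. c t l * (exp (x l) * (if l = i then 1 else 0))) / Z t -
         (\<Sum>l\<in>t. (if l = i then 1 else 0)) / 3) = (if i \<in> t then w t * (c t i * exp (x i) / Z t) - w t / 3 else 0)"
        by (simp add: algebra_simps)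
    qed
    also have "\<dots> = (\<Sum>t | t \<in> T \<and> i \<in> t. w t * (c t i * exp (x i) / Z t) - w t / 3)"
      using T(1) by (subst sum.inter_filter[symmetric]) auto
    finally show "(\<Sum>t | t \<in> T \<and> i \<in> t. w t * (c t i * exp (x i) / (\<Sum>l\<in>t. c t l * exp (x l)))) =
       (\<Sum>t | t \<in> T \<and> i \<in> t. w t) / 3"
      by (simp add: sum_subtractf sum_divide_distrib Z_def)
  qed
qed

section \<open>Rank bound for triple designs\<close>

text \<open>Gram-Schmidt. The condition that \<open>y b\<close> is nonzero at \<open>b\<close> and
  zero on the rest of \<open>C\<close> plays the part of linear independence.\<close>

lemma orthonormal_family_in_subspace:
  fixes W :: "('b \<Rightarrow> complex) set"
  assumes X: "finite X" and C: "finite C" "C \<subseteq> X"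
    and W_diff: "\<And>f g. f \<in> W \<Longrightarrow> g \<in> W \<Longrightarrow> (\<lambda>i. f i - g i) \<in> W"
    and W_scale: "\<And>f a. f \<in> W \<Longrightarrow> (\<lambda>i. a * f i) \<in> W"
    and y: "\<And>b. b \<in> C \<Longrightarrow> y b \<in> W" "\<And>b b'. b \<in> C \<Longrightarrow> b' \<in> C \<Longrightarrow> y b b' = 0 \<longleftrightarrow> b \<noteq> b'"
  shows "\<exists>q. (\<forall>b\<in>C. q b \<in> W) \<and>
    (\<forall>b\<in>C. \<forall>b'\<in>C. (\<Sum>i\<in>X. q b i * cnj (q b' i)) = (if b = b' then 1 else 0))"
proof -
  have W_sub: "(\<lambda>i. f i - (\<Sum>s\<in>D. a s * g s i)) \<in> W"
    if "finite D" "f \<in> W" "\<And>s. s \<in> D \<Longrightarrow> g s \<in> W" for f :: "'b \<Rightarrow> complex" and a g and D :: "'b set"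
    using that
  proof (induction D rule: finite_induct)
    case empty
    then show ?case by simp
  next
    case (insert d D)
    have "(\<lambda>i. (f i - (\<Sum>s\<in>D. a s * g s i)) - a d * g d i) \<in> W"
      by (rule W_diff[OF insert.IH W_scale]) (use insert.prems in auto)
    then show ?case using insert.hyps by (simp add: algebra_simps)
  qed
  \<comment> \<open>The induction also carries that the vectors found so far vanish on
    \<open>C - D\<close>. Subtracting projections onto them therefore leaves coordinate
    \<open>d\<close> of \<open>y d\<close> unchanged, so the new vector is nonzero and can be
    normalised.\<close>
  have "\<exists>q. (\<forall>b\<in>D. q b \<in> W \<and> (\<forall>l\<in>C - D. q b l = 0)) \<and>
    (\<forall>b\<in>D. \<forall>b'\<in>D. (\<Sum>i\<in>X. q b i * cnj (q b' i)) = (if b = b' then 1 else 0))"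
    if "finite D" "D \<subseteq> C" for D
    using that
  proof (induction D rule: finite_induct)
    case empty
    then show ?case by simp
  next
    case (insert d D)
    have "D \<subseteq> C" using insert.prems by simp
    from insert.IH[OF this] obtain q where q: "\<And>b. b \<in> D \<Longrightarrow> q b \<in> W" "\<And>b l. b \<in> D \<Longrightarrow> l \<in> C - D \<Longrightarrow> q b l = 0"
      and orth: "\<And>b b'. b \<in> D \<Longrightarrow> b' \<in> D \<Longrightarrow> (\<Sum>i\<in>X. q b i * cnj (q b' i)) = (if b = b' then 1 else 0)"
      by blast
    define a where "a s = (\<Sum>i\<in>X. y d i * cnj (q s i))" for s
    define p where "p i = y d i - (\<Sum>s\<in>D. a s * q s i)" for i
    have dC: "d \<in> C" "d \<in> X" using insert.prems C by auto
    have pW: "p \<in> W" unfolding p_def using insert.hyps q y(1)[OF dC(1)] by (intro W_sub) auto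
    have p0: "p l = 0" if "l \<in> C - insert d D" for l
      using that q(2)[of _ l] y(2)[OF dC(1), of l] by (auto simp: p_def)
    have "p d = y d d" using q(2)[of _ d] insert.hyps dC by (simp add: p_def)
    then have pd: "p d \<noteq> 0" using y(2)[of d d] dC by auto
    have p_orth: "(\<Sum>i\<in>X. p i * cnj (q b i)) = 0" if b: "b \<in> D" for b
    proof -
      have "(\<Sum>i\<in>X. p i * cnj (q b i)) = a b - (\<Sum>i\<in>X. \<Sum>s\<in>D. a s * (q s i * cnj (q b i)))"
        by (simp add: p_def a_def algebra_simps sum_subtractf sum_distrib_left)
      also have "(\<Sum>i\<in>X. \<Sum>s\<in>D. a s * (q s i * cnj (q b i))) = (\<Sum>s\<in>D. a s * (\<Sum>i\<in>X. q s i * cnj (q b i)))"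
        by (subst sum.swap) (simp add: sum_distrib_left)
      also have "\<dots> = (\<Sum>s\<in>D. if s = b then a s else 0)"
        using b orth by (intro sum.cong) auto
      also have "\<dots> = a b" using b insert.hyps by simp
      finally show ?thesis by simp
    qed
    define N where "N = (\<Sum>i\<in>X. (cmod (p i))\<^sup>2)"
    have "0 < (cmod (p d))\<^sup>2" using pd by simp
    also have "\<dots> \<le> N" unfolding N_def using X dC by (intro member_le_sum) auto
    finally have N: "N > 0" .
    define r where "r i = complex_of_real (1 / sqrt N) * p i" for i
    have rW: "r \<in> W" unfolding r_def using pW by (rule W_scale)
    have rr: "(\<Sum>i\<in>X. r i * cnj (r i)) = 1"
    proof -
      have "(\<Sum>i\<in>X. r i * cnj (r i)) = (\<Sum>i\<in>X. complex_of_real ((1 / N) * (cmod (p i))\<^sup>2))"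
      proof (intro sum.cong refl)
        fix i
        have "r i * cnj (r i) = complex_of_real ((cmod (r i))\<^sup>2)" by (simp only: complex_norm_square)
        also have "(cmod (r i))\<^sup>2 = (1 / N) * (cmod (p i))\<^sup>2"
          using N by (simp add: r_def norm_mult norm_divide power_mult_distrib power_divide)
        finally show "r i * cnj (r i) = complex_of_real ((1 / N) * (cmod (p i))\<^sup>2)" .
      qed
      also have "\<dots> = complex_of_real ((1 / N) * N)" by (simp only: N_def of_real_sum sum_distrib_left of_real_mult)
      finally show ?thesis using N by simp
    qed
    have rq: "(\<Sum>i\<in>X. r i * cnj (q b i)) = 0" if "b \<in> D" for b
      using p_orth[OF that] by (simp add: r_def mult.assoc flip: sum_distrib_left sum_divide_distrib)
    have qr: "(\<Sum>i\<in>X. q b i * cnj (r i)) = 0" if "b \<in> D" for b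
    proof -
      have "(\<Sum>i\<in>X. q b i * cnj (r i)) = cnj (\<Sum>i\<in>X. r i * cnj (q b i))"
        by (simp add: mult.commute)
      then show ?thesis using rq[OF that] by simp
    qed
    show ?case
    proof (intro exI[of _ "q(d := r)"] conjI ballI)
      fix b assume "b \<in> insert d D"
      then show "(q(d := r)) b \<in> W" using q rW by auto
    next
      fix b l assume "b \<in> insert d D" "l \<in> C - insert d D"
      then show "(q(d := r)) b l = 0" using q(2)[of b l] p0[of l] by (auto simp: r_def)
    next
      fix b b' assume "b \<in> insert d D" "b' \<in> insert d D"
      then show "(\<Sum>i\<in>X. (q(d := r)) b i * cnj ((q(d := r)) b' i)) = (if b = b' then 1 else 0)"
        using orth rr rq qr insert.hyps by auto
    qed
  qed
  from this[OF C(1)] show ?thesis by blast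
qed

text \<open>Let \<open>D = card C\<close>, \<open>n = card X\<close>, and let \<open>R\<close> be
  the sum of the squared moduli of the diagonal entries of the projection. Cauchy-Schwarz off the
  diagonal gives \<open>D\<^sup>2 \<le> S * (D - R)\<close>, and on the diagonal
  \<open>D\<^sup>2 \<le> R * n\<close>. Eliminating \<open>R\<close> and dividing by
  \<open>D\<close> gives the bound.\<close>

lemma orthonormal_kernel_card_bound:
  fixes a :: "'r \<Rightarrow> 'b \<Rightarrow> complex" and q :: "'d \<Rightarrow> 'b \<Rightarrow> complex"
  assumes X: "finite X" and C: "finite C"
    and col: "\<And>i. i \<in> X \<Longrightarrow> (\<Sum>t\<in>T. (cmod (a t i))\<^sup>2) = 1"
    and ker: "\<And>d t. d \<in> C \<Longrightarrow> t \<in> T \<Longrightarrow> (\<Sum>i\<in>X. a t i * q d i) = 0"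
    and orth: "\<And>d e. d \<in> C \<Longrightarrow> e \<in> C \<Longrightarrow>
      (\<Sum>i\<in>X. q d i * cnj (q e i)) = (if d = e then 1 else 0)"
    and S: "(\<Sum>(i, j)\<in>X \<times> X - Id. (cmod (\<Sum>t\<in>T. a t i * cnj (a t j)))\<^sup>2) \<le> S"
  shows "real (card C) * card X \<le> S * (real (card X) - card C)"
proof (cases "C = {}")
  case True
  have "0 \<le> (\<Sum>(i, j)\<in>X \<times> X - Id. (cmod (\<Sum>t\<in>T. a t i * cnj (a t j)))\<^sup>2)"
    by (intro sum_nonneg) auto
  then have "0 \<le> S" using S by linarith
  then show ?thesis using True by simp
next
  case False
  define D where "D = real (card C)"
  have D: "D > 0" using False C by (simp add: D_def card_gt_0_iff)
  define n where "n = real (card X)"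
  \<comment> \<open>\<open>Q\<close> is the orthogonal projection onto the span of the \<open>q d\<close>, and \<open>M Q = 0\<close>. As \<open>M\<close> has unit
    diagonal, the trace of \<open>M Q\<close> says that the off-diagonal part of \<open>M\<close> pairs with \<open>Q\<close> to \<open>- D\<close>.\<close>
  define M where "M i j = (\<Sum>t\<in>T. a t i * cnj (a t j))" for i j
  define Q where "Q i j = (\<Sum>d\<in>C. q d i * cnj (q d j))" for i j
  define Off where "Off = X \<times> X - Id"
  have finOff: "finite Off" using X by (simp add: Off_def)
  have split: "(\<Sum>i\<in>X. \<Sum>j\<in>X. g i j) = (\<Sum>i\<in>X. g i i) + (\<Sum>(i, j)\<in>Off. g i j)"
    for g :: "'b \<Rightarrow> 'b \<Rightarrow> 'c::comm_monoid_add"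
  proof -
    have "(\<Sum>i\<in>X. \<Sum>j\<in>X. g i j) = (\<Sum>(i, j)\<in>X \<times> X. g i j)"
      by (rule sum.cartesian_product)
    also have "X \<times> X = (\<lambda>i. (i, i)) ` X \<union> Off" by (auto simp: Off_def)
    also have "(\<Sum>(i, j)\<in>\<dots>. g i j) = (\<Sum>(i, j)\<in>(\<lambda>i. (i, i)) ` X. g i j) + (\<Sum>(i, j)\<in>Off. g i j)"
      using X finOff by (intro sum.union_disjoint) (auto simp: Off_def)
    also have "(\<Sum>(i, j)\<in>(\<lambda>i. (i, i)) ` X. g i j) = (\<Sum>i\<in>X. g i i)"
      by (subst sum.reindex) (auto simp: inj_on_def)
    finally show ?thesis .
  qed
  have Mii: "M i i = 1" if "i \<in> X" for i
  proof -
    have "M i i = complex_of_real (\<Sum>t\<in>T. (cmod (a t i))\<^sup>2)"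
      by (simp only: M_def of_real_sum complex_norm_square)
    then show ?thesis using col[OF that] by simp
  qed
  \<comment> \<open>The double sum is the sum over \<open>t\<close> and \<open>d\<close> of the
    squared modulus of \<open>\<Sum>i\<in>X. a t i * q d i\<close>, which vanishes by
    \<open>ker\<close>.\<close>
  have MQ: "(\<Sum>i\<in>X. \<Sum>j\<in>X. M i j * Q i j) = 0"
  proof -
    have "(\<Sum>i\<in>X. \<Sum>j\<in>X. M i j * Q i j) =
        (\<Sum>i\<in>X. \<Sum>j\<in>X. \<Sum>t\<in>T. \<Sum>d\<in>C. (a t i * q d i) * cnj (a t j * q d j))"
      unfolding M_def Q_def sum_product by (intro sum.cong refl) (simp add: mult_ac)
    also have "\<dots> = (\<Sum>i\<in>X. \<Sum>t\<in>T. \<Sum>d\<in>C. \<Sum>j\<in>X. (a t i * q d i) * cnj (a t j * q d j))"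
      by (intro sum.cong refl, subst sum.swap, intro sum.cong refl, rule sum.swap)
    also have "\<dots> = (\<Sum>t\<in>T. \<Sum>d\<in>C. \<Sum>i\<in>X. \<Sum>j\<in>X. (a t i * q d i) * cnj (a t j * q d j))"
      by (subst sum.swap, intro sum.cong refl, rule sum.swap)
    also have "\<dots> = (\<Sum>t\<in>T. \<Sum>d\<in>C. (\<Sum>i\<in>X. a t i * q d i) * (\<Sum>j\<in>X. cnj (a t j * q d j)))"
      by (simp add: sum_product)
    also have "\<dots> = 0" using ker by (intro sum.neutral ballI) simp
    finally show ?thesis .
  qed
  have Qtr: "(\<Sum>i\<in>X. Q i i) = of_real D"
  proof -
    have "(\<Sum>i\<in>X. Q i i) = (\<Sum>d\<in>C. \<Sum>i\<in>X. q d i * cnj (q d i))"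
      unfolding Q_def by (rule sum.swap)
    also have "\<dots> = (\<Sum>d\<in>C. 1)" using orth by (intro sum.cong) auto
    finally show ?thesis by (simp add: D_def)
  qed
  \<comment> \<open>The squared Frobenius norm of an orthogonal projection is its rank: by
    orthonormality only the terms with \<open>d = e\<close> survive.\<close>
  have QF: "(\<Sum>i\<in>X. \<Sum>j\<in>X. (cmod (Q i j))\<^sup>2) = D"
  proof -
    have "complex_of_real (\<Sum>i\<in>X. \<Sum>j\<in>X. (cmod (Q i j))\<^sup>2) = (\<Sum>i\<in>X. \<Sum>j\<in>X. Q i j * cnj (Q i j))"
      by (simp only: of_real_sum complex_norm_square)
    also have "\<dots> = (\<Sum>i\<in>X. \<Sum>j\<in>X. \<Sum>d\<in>C. \<Sum>e\<in>C. (q d i * cnj (q e i)) * (q e j * cnj (q d j)))"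
      unfolding Q_def cnj_sum sum_product by (intro sum.cong refl) (simp add: mult_ac)
    also have "\<dots> = (\<Sum>i\<in>X. \<Sum>d\<in>C. \<Sum>e\<in>C. \<Sum>j\<in>X. (q d i * cnj (q e i)) * (q e j * cnj (q d j)))"
      by (intro sum.cong refl, subst sum.swap, intro sum.cong refl, rule sum.swap)
    also have "\<dots> = (\<Sum>d\<in>C. \<Sum>e\<in>C. \<Sum>i\<in>X. \<Sum>j\<in>X. (q d i * cnj (q e i)) * (q e j * cnj (q d j)))"
      by (subst sum.swap, intro sum.cong refl, rule sum.swap)
    also have "\<dots> = (\<Sum>d\<in>C. \<Sum>e\<in>C. (\<Sum>i\<in>X. q d i * cnj (q e i)) * (\<Sum>j\<in>X. q e j * cnj (q d j)))"
      by (simp add: sum_product)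
    also have "\<dots> = (\<Sum>d\<in>C. \<Sum>e\<in>C. if d = e then 1 else 0)"
      using orth by (intro sum.cong refl) auto
    also have "\<dots> = of_real D" using C by (simp add: D_def)
    finally show ?thesis using of_real_eq_iff by blast
  qed
  have "(\<Sum>(i, j)\<in>Off. M i j * Q i j) = - of_real D"
  proof -
    have "(\<Sum>i\<in>X. M i i * Q i i) = of_real D"
      using Mii by (simp flip: Qtr)
    then show ?thesis using MQ split[of "\<lambda>i j. M i j * Q i j"] by (simp add: eq_neg_iff_add_eq_0 add.commute)
  qed
  then have "D = cmod (\<Sum>(i, j)\<in>Off. M i j * Q i j)" using D by simp
  also have "\<dots> \<le> (\<Sum>z\<in>Off. cmod (case z of (i, j) \<Rightarrow> M i j * Q i j))" by (rule norm_sum)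
  also have "\<dots> = (\<Sum>z\<in>Off. cmod (M (fst z) (snd z)) * cmod (Q (fst z) (snd z)))"
    by (simp add: case_prod_beta norm_mult)
  finally have "D\<^sup>2 \<le> (\<Sum>z\<in>Off. cmod (M (fst z) (snd z)) * cmod (Q (fst z) (snd z)))\<^sup>2"
    using D by (intro power_mono) auto
  also have "\<dots> \<le> (\<Sum>z\<in>Off. (cmod (M (fst z) (snd z)))\<^sup>2) * (\<Sum>z\<in>Off. (cmod (Q (fst z) (snd z)))\<^sup>2)"
    by (rule Cauchy_Schwarz_ineq_sum)
  also have "\<dots> \<le> S * (\<Sum>z\<in>Off. (cmod (Q (fst z) (snd z)))\<^sup>2)"
    using S by (intro mult_right_mono sum_nonneg) (auto simp: Off_def M_def case_prod_beta)
  also have "(\<Sum>z\<in>Off. (cmod (Q (fst z) (snd z)))\<^sup>2) = D - (\<Sum>i\<in>X. (cmod (Q i i))\<^sup>2)"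
    using QF split[of "\<lambda>i j. (cmod (Q i j))\<^sup>2"] by (simp add: case_prod_beta)
  finally have main: "D\<^sup>2 \<le> S * (D - (\<Sum>i\<in>X. (cmod (Q i i))\<^sup>2))" .
  have "0 \<le> (\<Sum>(i, j)\<in>X \<times> X - Id. (cmod (\<Sum>t\<in>T. a t i * cnj (a t j)))\<^sup>2)"
    by (intro sum_nonneg) auto
  then have S0: "0 \<le> S" using S by linarith
  have "D = cmod (\<Sum>i\<in>X. Q i i)" using Qtr D by simp
  also have "\<dots> \<le> (\<Sum>i\<in>X. cmod (Q i i))" by (rule norm_sum)
  finally have "D\<^sup>2 \<le> (\<Sum>i\<in>X. cmod (Q i i))\<^sup>2" using D by (intro power_mono) auto
  also have "\<dots> \<le> (\<Sum>i\<in>X. (cmod (Q i i))\<^sup>2) * n"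
    unfolding n_def by (rule sum_squared_le_sum_of_squares)
  finally have diag: "D\<^sup>2 \<le> (\<Sum>i\<in>X. (cmod (Q i i))\<^sup>2) * n" .
  have "D\<^sup>2 * n \<le> S * (D - (\<Sum>i\<in>X. (cmod (Q i i))\<^sup>2)) * n"
    using main by (intro mult_right_mono) (auto simp: n_def)
  also have "\<dots> = S * (D * n - (\<Sum>i\<in>X. (cmod (Q i i))\<^sup>2) * n)" by (simp add: algebra_simps)
  also have "\<dots> \<le> S * (D * n - D\<^sup>2)"
    using diag S0 by (intro mult_left_mono) auto
  finally have "D * (D * n) \<le> D * (S * (n - D))" by (simp add: power2_eq_square algebra_simps)
  then show ?thesis using D by (simp add: D_def n_def)
qed

text \<open>The \<open>y b\<close> are \<open>card C\<close> independent solutions of the relations.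
  After scaling, the kernel bound applies with \<open>S = 4 / \<beta> * card X\<close>, and the
  resulting inequality rearranges to the claim.\<close>

theorem triple_design_rank_bound:
  fixes X :: "'b set" and w :: "'b set \<Rightarrow> real" and \<alpha> :: "'b set \<Rightarrow> 'b \<Rightarrow> complex"
    and y :: "'b \<Rightarrow> 'b \<Rightarrow> complex" and \<beta> :: real
  assumes X: "finite X" and T: "finite T" "\<And>t. t \<in> T \<Longrightarrow> t \<subseteq> X \<and> card t = 3"
    and w: "\<And>t. t \<in> T \<Longrightarrow> w t > 0"
    and pair: "\<And>i j. i \<in> X \<Longrightarrow> j \<in> X \<Longrightarrow> i \<noteq> j \<Longrightarrow> (\<Sum>t | t \<in> T \<and> i \<in> t \<and> j \<in> t. w t) \<le> 1"
    and deg: "\<And>i. i \<in> X \<Longrightarrow> \<beta> / 2 \<le> (\<Sum>t | t \<in> T \<and> i \<in> t. w t)" and \<beta>: "\<beta> > 0"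
    and \<alpha>: "\<And>t i. t \<in> T \<Longrightarrow> i \<in> t \<Longrightarrow> \<alpha> t i \<noteq> 0"
    and C: "C \<subseteq> X"
    and y: "\<And>b b'. b \<in> C \<Longrightarrow> b' \<in> C \<Longrightarrow> y b b' = 0 \<longleftrightarrow> b \<noteq> b'"
    and rel: "\<And>b t. b \<in> C \<Longrightarrow> t \<in> T \<Longrightarrow> (\<Sum>i\<in>t. \<alpha> t i * y b i) = 0"
  shows "real (card C) * (\<beta> + 4) \<le> 4 * card X"
proof -
  have fin_t: "finite t" "t \<subseteq> X" "t \<noteq> {}" if "t \<in> T" for t
    using T(2)[OF that] X finite_subset by auto
  have finC: "finite C" using C X finite_subset by blast
  define c where "c t i = (cmod (\<alpha> t i))\<^sup>2" for t i
  have c: "c t i > 0" if "t \<in> T" "i \<in> t" for t i using \<alpha>[OF that] by (simp add: c_def)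
  have "\<exists>x :: 'b \<Rightarrow> real. \<forall>i.
    (\<Sum>t | t \<in> T \<and> i \<in> t. w t * (c t i * exp (x i) / (\<Sum>l\<in>t. c t l * exp (x l)))) =
    (\<Sum>t | t \<in> T \<and> i \<in> t. w t) / 3"
    by (rule triple_scaling_exists[OF X T(1)]) (use T w c in auto)
  then obtain x :: "'b \<Rightarrow> real" where x: "\<And>i.
    (\<Sum>t | t \<in> T \<and> i \<in> t. w t * (c t i * exp (x i) / (\<Sum>l\<in>t. c t l * exp (x l)))) =
    (\<Sum>t | t \<in> T \<and> i \<in> t. w t) / 3" by blast
  define Z where "Z t = (\<Sum>l\<in>t. c t l * exp (x l))" for t
  have Z: "Z t > 0" if "t \<in> T" for t
    unfolding Z_def using fin_t[OF that] c[OF that] by (intro sum_pos) auto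
  \<comment> \<open>Each \<open>p t\<close> is a probability distribution on \<open>t\<close>. By
    the choice of \<open>x\<close>, the values \<open>w t * p t i\<close> add up over
    \<open>t\<close> to \<open>b i\<close>, a third of the weight of the triples through
    \<open>i\<close>.\<close>
  define p where "p t i = (if i \<in> t then c t i * exp (x i) / Z t else 0)" for t i
  define b where "b i = (\<Sum>t | t \<in> T \<and> i \<in> t. w t) / 3" for i
  have b: "b i \<ge> \<beta> / 6" "b i > 0" if "i \<in> X" for i
    using deg[OF that] \<beta> by (auto simp: b_def)
  have p_nonneg: "p t i \<ge> 0" if "t \<in> T" for t i
    using c[OF that, of i] Z[OF that] by (auto simp: p_def intro!: mult_nonneg_nonneg divide_nonneg_nonneg)
  have p_sum: "(\<Sum>i\<in>X. p t i) = 1" if "t \<in> T" for t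
  proof -
    have "(\<Sum>i\<in>X. p t i) = (\<Sum>i\<in>t. c t i * exp (x i) / Z t)"
      using fin_t[OF that] X by (intro sum.mono_neutral_cong_right) (auto simp: p_def)
    also have "\<dots> = Z t / Z t" by (simp only: Z_def flip: sum_divide_distrib)
    finally show ?thesis using Z[OF that] by simp
  qed
  have col: "(\<Sum>t\<in>T. w t * p t i) = b i" for i
  proof -
    have "(\<Sum>t\<in>T. w t * p t i) = (\<Sum>t | t \<in> T \<and> i \<in> t. w t * (c t i * exp (x i) / Z t))"
      using T(1) by (intro sum.mono_neutral_cong_right) (auto simp: p_def)
    then show ?thesis using x[of i] by (simp add: Z_def b_def)
  qed
  \<comment> \<open>Rows and columns of the relation matrix are scaled so that
    \<open>(cmod (a t i))\<^sup>2 = w t * p t i / b i\<close>, which makes the columns unit vectors.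
    The solutions \<open>y'\<close> below undo the column factors and so stay in the kernel.\<close>
  define a where "a t i = (if i \<in> t then complex_of_real (sqrt (w t * exp (x i) / (Z t * b i))) * \<alpha> t i else 0)" for t i
  have a_norm: "(cmod (a t i))\<^sup>2 = w t * p t i / b i" if "t \<in> T" "i \<in> X" for t i
  proof (cases "i \<in> t")
    case True
    have "w t * exp (x i) / (Z t * b i) \<ge> 0"
      using w[OF that(1)] Z[OF that(1)] b(2)[OF that(2)] by simp
    then have "(cmod (a t i))\<^sup>2 = w t * exp (x i) / (Z t * b i) * c t i"
      using True by (simp add: a_def norm_mult power_mult_distrib c_def)
    then show ?thesis using True by (simp add: p_def)
  qed (simp add: a_def p_def)
  define W where "W = {f. \<forall>t\<in>T. (\<Sum>i\<in>X. a t i * f i) = 0}"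
  define y' where "y' d i = complex_of_real (sqrt (b i / exp (x i))) * y d i" for d i
  have y'W: "y' d \<in> W" if d: "d \<in> C" for d
  proof -
    have "(\<Sum>i\<in>X. a t i * y' d i) = 0" if t: "t \<in> T" for t
    proof -
      have "(\<Sum>i\<in>X. a t i * y' d i) = (\<Sum>i\<in>t. complex_of_real (sqrt (w t / Z t)) * (\<alpha> t i * y d i))"
      proof (rule sum.mono_neutral_cong_right)
        fix i assume i: "i \<in> t"
        then have bi: "b i > 0" using b fin_t[OF t] by auto
        have "sqrt (w t * exp (x i) / (Z t * b i)) * sqrt (b i / exp (x i)) = sqrt (w t / Z t)"
          using bi by (simp flip: real_sqrt_mult)
        then have "complex_of_real (sqrt (w t * exp (x i) / (Z t * b i))) * complex_of_real (sqrt (b i / exp (x i)))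
            = complex_of_real (sqrt (w t / Z t))" by (simp only: flip: of_real_mult)
        then show "a t i * y' d i = complex_of_real (sqrt (w t / Z t)) * (\<alpha> t i * y d i)"
          using i by (simp only: a_def y'_def if_True) (metis (no_types, lifting) mult.assoc mult.left_commute)
      qed (use X fin_t[OF t] in \<open>auto simp: a_def\<close>)
      also have "\<dots> = complex_of_real (sqrt (w t / Z t)) * (\<Sum>i\<in>t. \<alpha> t i * y d i)"
        by (rule sum_distrib_left[symmetric])
      finally show ?thesis using rel[OF d t] by simp
    qed
    then show ?thesis by (simp add: W_def)
  qed
  have "\<exists>q. (\<forall>d\<in>C. q d \<in> W) \<and>
    (\<forall>d\<in>C. \<forall>e\<in>C. (\<Sum>i\<in>X. q d i * cnj (q e i)) = (if d = e then 1 else 0))"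
  proof (rule orthonormal_family_in_subspace[OF X finC C, of W y'])
    fix f g assume "f \<in> W" "g \<in> W"
    then show "(\<lambda>i. f i - g i) \<in> W"
      by (simp add: W_def right_diff_distrib sum_subtractf)
  next
    fix f s assume f: "f \<in> W"
    have "(\<Sum>i\<in>X. a t i * (s * f i)) = s * (\<Sum>i\<in>X. a t i * f i)" for t
      by (simp add: sum_distrib_left mult.left_commute)
    then show "(\<lambda>i. s * f i) \<in> W" using f by (simp add: W_def)
  next
    fix d e assume de: "d \<in> C" "e \<in> C"
    then have "b e > 0" using b C by auto
    then show "y' d e = 0 \<longleftrightarrow> d \<noteq> e" using y[OF de] by (simp add: y'_def)
  qed (use y'W in auto)
  then obtain q where q: "\<And>d. d \<in> C \<Longrightarrow> q d \<in> W"
    "\<And>d e. d \<in> C \<Longrightarrow> e \<in> C \<Longrightarrow> (\<Sum>i\<in>X. q d i * cnj (q e i)) = (if d = e then 1 else 0)"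
    by blast
  \<comment> \<open>Only triples containing both \<open>i\<close> and \<open>j\<close> contribute.
    Their total weight is at most \<open>1\<close> by \<open>pair\<close>, so Cauchy-Schwarz with
    the weights \<open>w t\<close> costs no further factor.\<close>
  have M_bound: "(cmod (\<Sum>t\<in>T. a t i * cnj (a t j)))\<^sup>2 \<le> (\<Sum>t\<in>T. w t * p t i / b i * (p t j / b j))"
    if ij: "i \<in> X" "j \<in> X" "i \<noteq> j" for i j
  proof -
    let ?T = "{t. t \<in> T \<and> i \<in> t \<and> j \<in> t}"
    have sub: "?T \<subseteq> T" by auto
    have "cmod (\<Sum>t\<in>T. a t i * cnj (a t j)) = cmod (\<Sum>t\<in>?T. a t i * cnj (a t j))"
      using T(1) by (intro arg_cong[where f = cmod] sum.mono_neutral_right) (auto simp: a_def)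
    also have "\<dots> \<le> (\<Sum>t\<in>?T. cmod (a t i * cnj (a t j)))" by (rule norm_sum)
    also have "\<dots> = (\<Sum>t\<in>?T. sqrt (w t) * (cmod (a t i) * cmod (a t j) / sqrt (w t)))"
      by (intro sum.cong refl) (auto dest!: w simp: norm_mult)
    finally have "(cmod (\<Sum>t\<in>T. a t i * cnj (a t j)))\<^sup>2 \<le>
        (\<Sum>t\<in>?T. sqrt (w t) * (cmod (a t i) * cmod (a t j) / sqrt (w t)))\<^sup>2"
      by (intro power_mono) auto
    also have "\<dots> \<le> (\<Sum>t\<in>?T. (sqrt (w t))\<^sup>2) * (\<Sum>t\<in>?T. (cmod (a t i) * cmod (a t j) / sqrt (w t))\<^sup>2)"
      by (rule Cauchy_Schwarz_ineq_sum)
    also have "(\<Sum>t\<in>?T. (sqrt (w t))\<^sup>2) = (\<Sum>t\<in>?T. w t)"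
      by (intro sum.cong refl) (auto dest!: w)
    also have "(\<Sum>t\<in>?T. (cmod (a t i) * cmod (a t j) / sqrt (w t))\<^sup>2) = (\<Sum>t\<in>?T. w t * p t i / b i * (p t j / b j))"
    proof (intro sum.cong refl)
      fix t assume "t \<in> ?T"
      then have t: "t \<in> T" by auto
      show "(cmod (a t i) * cmod (a t j) / sqrt (w t))\<^sup>2 = w t * p t i / b i * (p t j / b j)"
        using w[OF t] by (simp add: power_mult_distrib power_divide a_norm t ij)
    qed
    also have "(\<Sum>t\<in>?T. w t) * (\<Sum>t\<in>?T. w t * p t i / b i * (p t j / b j)) \<le>
        1 * (\<Sum>t\<in>?T. w t * p t i / b i * (p t j / b j))"
      using pair[OF ij] b(2) ij p_nonneg w
      by (intro mult_right_mono sum_nonneg) (auto intro!: mult_nonneg_nonneg divide_nonneg_pos intro: less_imp_le)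
    also have "\<dots> \<le> (\<Sum>t\<in>T. w t * p t i / b i * (p t j / b j))"
      unfolding mult_1 using T(1) b(2) ij p_nonneg w
      by (intro sum_mono2) (auto intro!: mult_nonneg_nonneg divide_nonneg_pos intro: less_imp_le)
    finally show ?thesis .
  qed
  \<comment> \<open>Over the triples through \<open>i\<close>, of total weight
    \<open>3 * b i\<close>, the weighted mean of \<open>p t i\<close> is \<open>1 / 3\<close>; by
    Cauchy-Schwarz the mean square is at least \<open>1 / 9\<close>.\<close>
  have second: "b i / 3 \<le> (\<Sum>t\<in>T. w t * (p t i)\<^sup>2)" if i: "i \<in> X" for i
  proof -
    let ?T = "{t. t \<in> T \<and> i \<in> t}"
    have "b i = (\<Sum>t\<in>?T. sqrt (w t) * (sqrt (w t) * p t i))"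
    proof -
      have "b i = (\<Sum>t\<in>?T. w t * p t i)"
        unfolding col[symmetric] using T(1) by (intro sum.mono_neutral_right) (auto simp: p_def)
      also have "\<dots> = (\<Sum>t\<in>?T. sqrt (w t) * (sqrt (w t) * p t i))"
        by (intro sum.cong refl) (auto dest!: w simp flip: mult.assoc)
      finally show ?thesis .
    qed
    then have "(b i)\<^sup>2 \<le> (\<Sum>t\<in>?T. (sqrt (w t))\<^sup>2) * (\<Sum>t\<in>?T. (sqrt (w t) * p t i)\<^sup>2)"
      using Cauchy_Schwarz_ineq_sum[of "\<lambda>t. sqrt (w t)" "\<lambda>t. sqrt (w t) * p t i" ?T] by simp
    also have "(\<Sum>t\<in>?T. (sqrt (w t))\<^sup>2) = 3 * b i"
    proof -
      have "(\<Sum>t\<in>?T. (sqrt (w t))\<^sup>2) = (\<Sum>t\<in>?T. w t)"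
        by (intro sum.cong refl) (auto dest!: w)
      then show ?thesis by (simp add: b_def)
    qed
    also have "(\<Sum>t\<in>?T. (sqrt (w t) * p t i)\<^sup>2) = (\<Sum>t\<in>T. w t * (p t i)\<^sup>2)"
      using T(1) by (intro sum.mono_neutral_cong_left) (auto dest!: w simp: p_def power_mult_distrib power_divide)
    finally have "b i * b i \<le> b i * (3 * (\<Sum>t\<in>T. w t * (p t i)\<^sup>2))"
      by (simp add: power2_eq_square algebra_simps)
    then show ?thesis using b(2)[OF i] by simp
  qed
  have "(\<Sum>(i, j)\<in>X \<times> X - Id. (cmod (\<Sum>t\<in>T. a t i * cnj (a t j)))\<^sup>2) \<le>
      (\<Sum>(i, j)\<in>X \<times> X - Id. (\<Sum>t\<in>T. w t * p t i / b i * (p t j / b j)))"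
    using M_bound by (intro sum_mono) auto
  also have "\<dots> = (\<Sum>i\<in>X. \<Sum>j\<in>X - {i}. \<Sum>t\<in>T. w t * p t i / b i * (p t j / b j))"
    using X by (subst sum.Sigma) (auto intro!: sum.cong)
  \<comment> \<open>The factor \<open>6 / \<beta>\<close> comes from
    \<open>b j \<ge> \<beta> / 6\<close>. The \<open>p t j\<close> with \<open>j \<noteq> i\<close>
    add up to \<open>1 - p t i\<close>, and by \<open>second\<close> the weighted sum of
    \<open>p t i * (1 - p t i)\<close> is at most \<open>2 / 3 * b i\<close>.\<close>
  also have "\<dots> \<le> (\<Sum>i\<in>X. 4 / \<beta>)"
  proof (intro sum_mono)
    fix i assume i: "i \<in> X"
    have "(\<Sum>j\<in>X - {i}. \<Sum>t\<in>T. w t * p t i / b i * (p t j / b j)) \<le>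
        (\<Sum>j\<in>X - {i}. \<Sum>t\<in>T. w t * p t i / b i * (p t j * (6 / \<beta>)))"
    proof (intro sum_mono mult_left_mono)
      fix j t assume jt: "j \<in> X - {i}" "t \<in> T"
      have "1 / b j \<le> 6 / \<beta>" using b[of j] jt \<beta> by (simp add: field_simps)
      then show "p t j / b j \<le> p t j * (6 / \<beta>)"
        using mult_left_mono[OF _ p_nonneg[OF jt(2), of j]] by fastforce
      show "0 \<le> w t * p t i / b i"
        using w[OF jt(2)] p_nonneg[OF jt(2)] b(2)[OF i] by simp
    qed
    also have "\<dots> = (6 / \<beta>) / b i * (\<Sum>t\<in>T. w t * p t i * (\<Sum>j\<in>X - {i}. p t j))"
      by (subst sum.swap) (simp add: sum_distrib_left sum_distrib_right mult_ac)
    also have "(\<Sum>t\<in>T. w t * p t i * (\<Sum>j\<in>X - {i}. p t j)) = (\<Sum>t\<in>T. w t * p t i - w t * (p t i)\<^sup>2)"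
    proof (intro sum.cong refl)
      fix t assume t: "t \<in> T"
      have "(\<Sum>j\<in>X - {i}. p t j) = 1 - p t i"
        using p_sum[OF t] sum.remove[OF X i, of "p t"] by simp
      then show "w t * p t i * (\<Sum>j\<in>X - {i}. p t j) = w t * p t i - w t * (p t i)\<^sup>2"
        by (simp only: right_diff_distrib power2_eq_square mult.assoc mult_1_right)
    qed
    also have "\<dots> = b i - (\<Sum>t\<in>T. w t * (p t i)\<^sup>2)" by (simp add: sum_subtractf col)
    also have "(6 / \<beta>) / b i * \<dots> \<le> (6 / \<beta>) / b i * (2 / 3 * b i)"
      using second[OF i] b(2)[OF i] \<beta> by (intro mult_left_mono) auto
    also have "\<dots> = 4 / \<beta>" using b(2)[OF i] by simp
    finally show "(\<Sum>j\<in>X - {i}. \<Sum>t\<in>T. w t * p t i / b i * (p t j / b j)) \<le> 4 / \<beta>" .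
  qed
  also have "\<dots> = 4 / \<beta> * card X" by simp
  finally have S: "(\<Sum>(i, j)\<in>X \<times> X - Id. (cmod (\<Sum>t\<in>T. a t i * cnj (a t j)))\<^sup>2) \<le> 4 / \<beta> * card X" .
  have unit: "(\<Sum>t\<in>T. (cmod (a t i))\<^sup>2) = 1" if "i \<in> X" for i
  proof -
    have "(\<Sum>t\<in>T. (cmod (a t i))\<^sup>2) = (\<Sum>t\<in>T. w t * p t i) / b i"
      using that by (simp add: a_norm sum_divide_distrib)
    then show ?thesis using b(2)[OF that] by (simp add: col)
  qed
  have "real (card C) * card X \<le> 4 / \<beta> * card X * (real (card X) - card C)"
    by (rule orthonormal_kernel_card_bound[OF X finC unit _ q(2) S]) (use q(1) in \<open>auto simp: W_def\<close>)
  show ?thesis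
  proof (cases "card X = 0")
    case True
    then show ?thesis using X C by simp
  next
    case False
    have "real (card X) * card C \<le> real (card X) * (4 / \<beta> * (real (card X) - card C))"
      using \<open>real (card C) * card X \<le> _\<close> by (simp only: mult_ac)
    then have "real (card C) \<le> 4 / \<beta> * (real (card X) - card C)"
      by (rule mult_left_le_imp_le) (use False in simp)
    then show ?thesis using \<beta> by (simp add: field_simps)
  qed
qed

section \<open>Collinear triples in a contraction\<close>

text \<open>Modulo the span of \<open>A\<close>, a collinear triple satisfies a linear relation with
  three nonzero coefficients. Extend a basis of \<open>A\<close> to one of
  \<open>A \<union> Y\<close>: the coordinates at the new basis elements vanish on the span of
  \<open>A\<close>, hence solve all these relations, and their number is the rank of the
  contraction.\<close>

theorem collinear_triples_rank_bound:
  fixes A Y :: "(complex ^ 'n) set" and \<beta> :: real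
  assumes Y: "finite Y"
    and nonpar: "\<And>i j. i \<in> Y \<Longrightarrow> j \<in> Y \<Longrightarrow> i \<noteq> j \<Longrightarrow> i \<notin> vec.span (insert j A)"
    and deg: "\<And>i. i \<in> Y \<Longrightarrow>
      \<beta> \<le> card {j \<in> Y - {i}. \<exists>l\<in>Y - {i, j}. l \<in> vec.span (insert i (insert j A))}"
    and \<beta>: "\<beta> > 0"
  shows "(real (vec.dim (A \<union> Y)) - vec.dim A) * (\<beta> + 4) \<le> 4 * card Y"
proof -
  define T where "T = {t. t \<subseteq> Y \<and> card t = 3 \<and> (\<forall>i\<in>t. i \<in> vec.span ((t - {i}) \<union> A))}"
  define line where "line t = Y \<inter> vec.span (t \<union> A)" for t
  \<comment> \<open>A pair on a line with \<open>m\<close> elements of \<open>Y\<close> lies in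
    \<open>m - 2\<close> triples of that line, so this weight gives the pair total one.\<close>
  define w where "w t = 1 / (real (card (line t)) - 2)" for t
  have finT: "finite T" using Y by (simp add: T_def)
  have T: "t \<subseteq> Y \<and> card t = 3" if "t \<in> T" for t using that by (simp add: T_def)
  have fin_line: "finite (line t)" for t using Y by (simp add: line_def)
  have line_sub: "t \<subseteq> line t" if "t \<subseteq> Y" for t
    using that by (auto simp: line_def intro: vec.span_base)
  have w: "w t > 0" if "t \<in> T" for t
    using card_mono[OF fin_line line_sub, of t] T[OF that] by (simp add: w_def)
  have T_intro: "{i, j, l} \<in> T"
    if ij: "i \<in> Y" "j \<in> Y" "i \<noteq> j" and l: "l \<in> line {i, j} - {i, j}" for i j l
  proof -
    have lY: "l \<in> Y" "l \<noteq> i" "l \<noteq> j" "l \<in> vec.span (insert i (insert j A))"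
      using l by (auto simp: line_def)
    have i: "i \<in> vec.span (insert l (insert j A))"
      using vec.in_span_insert[OF lY(4)] nonpar[of l j] lY ij by auto
    have "l \<in> vec.span (insert j (insert i A))" using lY(4) by (simp add: insert_commute)
    then have j: "j \<in> vec.span (insert l (insert i A))"
      using vec.in_span_insert[of l j "insert i A"] nonpar[of l i] lY ij by auto
    have "{i, j, l} - {i} = {l, j}" "{i, j, l} - {j} = {l, i}" "{i, j, l} - {l} = {i, j}" using ij lY by auto
    then show ?thesis using i j lY ij by (auto simp: T_def)
  qed
  have T_elim: "\<exists>l \<in> line {i, j} - {i, j}. t = {i, j, l}"
    if t: "t \<in> T" "i \<in> t" "j \<in> t" "i \<noteq> j" for t i j
  proof -
    have "card (t - {i, j}) = 1"
      using T[OF t(1)] t by (subst card_Diff_subset) auto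
    then obtain l where l: "t - {i, j} = {l}" by (auto simp: card_1_singleton_iff)
    then have "t = {i, j, l}" "l \<noteq> i" "l \<noteq> j" using t by auto
    moreover from this have "t - {l} = {i, j}" using t by auto
    ultimately show ?thesis using t(1) by (auto simp: T_def line_def)
  qed
  have line_eq: "line {i, j, l} = line {i, j}" if "l \<in> line {i, j} - {i, j}" for i j l
  proof -
    have "l \<in> vec.span ({i, j} \<union> A)" using that by (simp add: line_def)
    moreover have "{i, j, l} \<union> A = insert l ({i, j} \<union> A)" by auto
    ultimately show ?thesis by (simp only: line_def vec.span_redundant)
  qed
  have pair_sum: "(\<Sum>t | t \<in> T \<and> i \<in> t \<and> j \<in> t. w t) =
      (if \<exists>l\<in>Y - {i, j}. l \<in> vec.span (insert i (insert j A)) then 1 else 0)"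
    if ij: "i \<in> Y" "j \<in> Y" "i \<noteq> j" for i j
  proof -
    let ?L = "line {i, j} - {i, j}"
    have "{t. t \<in> T \<and> i \<in> t \<and> j \<in> t} = (\<lambda>l. {i, j, l}) ` ?L"
      using T_intro[OF ij] T_elim[of _ i j] ij by blast
    moreover have "inj_on (\<lambda>l. {i, j, l}) ?L" by (auto simp: inj_on_def)
    ultimately have "(\<Sum>t | t \<in> T \<and> i \<in> t \<and> j \<in> t. w t) = (\<Sum>l\<in>?L. w {i, j, l})"
      by (simp add: sum.reindex)
    also have "\<dots> = (\<Sum>l\<in>?L. 1 / real (card ?L))"
    proof (intro sum.cong refl)
      fix l assume l: "l \<in> ?L"
      have sub: "{i, j} \<subseteq> line {i, j}" using ij by (intro line_sub) auto
      then have "card ?L = card (line {i, j}) - 2" "card (line {i, j}) \<ge> 2"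
        using ij card_mono[OF fin_line sub] by (auto simp: card_Diff_subset)
      then show "w {i, j, l} = 1 / real (card ?L)"
        by (simp add: w_def line_eq[OF l] of_nat_diff)
    qed
    also have "\<dots> = (if ?L \<noteq> {} then 1 else 0)"
      using fin_line[of "{i, j}"] by auto
    also have "?L \<noteq> {} \<longleftrightarrow> (\<exists>l\<in>Y - {i, j}. l \<in> vec.span (insert i (insert j A)))"
      by (auto simp: line_def)
    finally show ?thesis .
  qed
  have degT: "\<beta> / 2 \<le> (\<Sum>t | t \<in> T \<and> i \<in> t. w t)" if i: "i \<in> Y" for i
  proof -
    \<comment> \<open>Double counting: a triple through \<open>i\<close> has two other elements, so
      the pair totals, each \<open>0\<close> or \<open>1\<close>, add up to twice the weight at
      \<open>i\<close>. This is why the degree condition reads \<open>\<beta> / 2\<close>.\<close>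
    have "(\<Sum>t | t \<in> T \<and> i \<in> t. 2 * w t) = (\<Sum>t | t \<in> T \<and> i \<in> t. \<Sum>j | j \<in> Y - {i} \<and> j \<in> t. w t)"
    proof (intro sum.cong refl)
      fix t assume t: "t \<in> {t. t \<in> T \<and> i \<in> t}"
      then have "{j. j \<in> Y - {i} \<and> j \<in> t} = t - {i}" using T[of t] by auto
      moreover have "card (t - {i}) = 2" using T[of t] t by (subst card_Diff_singleton) auto
      ultimately show "2 * w t = (\<Sum>j | j \<in> Y - {i} \<and> j \<in> t. w t)" by simp
    qed
    also have "\<dots> = (\<Sum>j\<in>Y - {i}. \<Sum>t | t \<in> {t. t \<in> T \<and> i \<in> t} \<and> j \<in> t. w t)"
      using finT Y by (intro sum.swap_restrict) auto
    also have "\<dots> = (\<Sum>j\<in>Y - {i}. if \<exists>l\<in>Y - {i, j}. l \<in> vec.span (insert i (insert j A)) then 1 else 0)"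
    proof (intro sum.cong refl)
      fix j assume "j \<in> Y - {i}"
      then have j: "j \<in> Y" "i \<noteq> j" by auto
      show "(\<Sum>t | t \<in> {t. t \<in> T \<and> i \<in> t} \<and> j \<in> t. w t) =
          (if \<exists>l\<in>Y - {i, j}. l \<in> vec.span (insert i (insert j A)) then 1 else 0)"
        using pair_sum[OF i j] by (simp only: mem_Collect_eq conj_assoc)
    qed
    also have "\<dots> = card {j \<in> Y - {i}. \<exists>l\<in>Y - {i, j}. l \<in> vec.span (insert i (insert j A))}"
      using Y by (subst sum.inter_filter[symmetric]) auto
    finally show ?thesis using deg[OF i] by (simp flip: sum_distrib_left)
  qed
  \<comment> \<open>One coefficient is taken to be \<open>1\<close>; if another vanished, one
    element of the triple would lie in the span of \<open>A\<close> and a second one, against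
    \<open>nonpar\<close>.\<close>
  have "\<exists>\<alpha>. (\<forall>i\<in>t. \<alpha> i \<noteq> 0) \<and> (\<Sum>i\<in>t. \<alpha> i *s i) \<in> vec.span A" if t: "t \<in> T" for t
  proof -
    have "t \<noteq> {}" using T[OF t] by auto
    then obtain i where i: "i \<in> t" by auto
    have "t \<noteq> {i}" using T[OF t] by auto
    then obtain j where j: "j \<in> t" "i \<noteq> j" using i by auto
    obtain l where l: "l \<in> line {i, j}" "l \<noteq> i" "l \<noteq> j" "t = {i, j, l}" using T_elim[OF t i j] by auto
    have Yt: "i \<in> Y" "j \<in> Y" "l \<in> Y" using T[OF t] l by auto
    have "l \<in> vec.span (insert i (insert j A))" using l by (simp add: line_def)
    then obtain a b where ab: "l - a *s i - b *s j \<in> vec.span A"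
      by (auto simp: vec.span_breakdown_eq)
    have "a \<noteq> 0"
    proof
      assume "a = 0"
      then have "l - b *s j \<in> vec.span A" using ab by simp
      then have "l \<in> vec.span (insert j A)" by (auto simp: vec.span_breakdown_eq)
      then show False using nonpar Yt l by auto
    qed
    moreover have "b \<noteq> 0"
    proof
      assume "b = 0"
      then have "l - a *s i \<in> vec.span A" using ab by simp
      then have "l \<in> vec.span (insert i A)" by (auto simp: vec.span_breakdown_eq)
      then show False using nonpar Yt l by auto
    qed
    ultimately show ?thesis using ab l j
      by (intro exI[of _ "(\<lambda>_. 1)(i := - a, j := - b)"]) (auto simp: algebra_simps)
  qed
  then obtain \<alpha> where \<alpha>: "\<And>t i. t \<in> T \<Longrightarrow> i \<in> t \<Longrightarrow> \<alpha> t i \<noteq> 0"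
    "\<And>t. t \<in> T \<Longrightarrow> (\<Sum>i\<in>t. \<alpha> t i *s i) \<in> vec.span A" by metis
  obtain A' where A': "A' \<subseteq> A" "vec.independent A'" "A \<subseteq> vec.span A'"
    using vec.maximal_independent_subset[of A] by blast
  have span_A': "vec.span A' = vec.span A"
    using A' by (metis subset_antisym vec.span_minimal vec.span_mono vec.subspace_span)
  obtain B where B: "A' \<subseteq> B" "B \<subseteq> A' \<union> Y" "vec.independent B" "A' \<union> Y \<subseteq> vec.span B"
    using vec.maximal_independent_subset_extend[of A' "A' \<union> Y"] A'(2) by blast
  define C where "C = B - A'"
  have CY: "C \<subseteq> Y" using B by (auto simp: C_def)
  have "finite B" using B(3) by (rule vec.finiteI_independent)
  have dimA: "vec.dim A = card A'"
    by (metis A'(2) span_A' vec.dim_eq_card)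
  have "vec.span B = vec.span (A \<union> Y)"
  proof
    show "vec.span B \<subseteq> vec.span (A \<union> Y)" using B A' by (intro vec.span_mono) auto
    have "A \<union> Y \<subseteq> vec.span B"
      using B A'(3) vec.span_mono[OF B(1)] by blast
    then show "vec.span (A \<union> Y) \<subseteq> vec.span B" by (rule vec.span_minimal) simp
  qed
  then have "vec.dim (A \<union> Y) = card B" using B(3) vec.dim_eq_card by metis
  moreover have "card B = card A' + card C"
    using \<open>finite B\<close> B(1) unfolding C_def by (metis card_Diff_subset card_mono finite_subset le_add_diff_inverse)
  ultimately have card_C: "real (card C) = real (vec.dim (A \<union> Y)) - vec.dim A" using dimA by simp
  have YB: "i \<in> vec.span B" if "i \<in> Y" for i using that B by auto
  have "real (card C) * (\<beta> + 4) \<le> 4 * card Y"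
  proof (rule triple_design_rank_bound[OF Y finT T w _ degT \<beta> \<alpha>(1) CY,
        where y = "\<lambda>b i. vec.representation B i b"])
    fix i j assume "i \<in> Y" "j \<in> Y" "i \<noteq> j"
    then show "(\<Sum>t | t \<in> T \<and> i \<in> t \<and> j \<in> t. w t) \<le> 1" by (simp add: pair_sum)
  next
    fix b b' assume "b \<in> C" "b' \<in> C"
    then show "vec.representation B b' b = 0 \<longleftrightarrow> b \<noteq> b'"
      using vec.representation_basis[OF B(3), of b'] by (auto simp: C_def)
  next
    fix b t assume b: "b \<in> C" and t: "t \<in> T"
    let ?u = "\<Sum>i\<in>t. \<alpha> t i *s i"
    have tY: "t \<subseteq> Y" using T[OF t] by simp
    have uA: "?u \<in> vec.span A'" using \<alpha>(2)[OF t] span_A' by simp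
    have "(\<Sum>i\<in>t. \<alpha> t i * vec.representation B i b) = (\<Sum>i\<in>t. vec.representation B (\<alpha> t i *s i) b)"
      using tY YB by (intro sum.cong refl) (subst vec.representation_scale[OF B(3)], auto)
    also have "\<dots> = vec.representation B ?u b"
      using tY YB by (subst vec.representation_sum[OF B(3)]) (auto intro: vec.span_scale)
    \<comment> \<open>The vector lies in the span of \<open>A'\<close>, so its coordinates are
      supported on \<open>A'\<close> and vanish at \<open>b \<in> B - A'\<close>.\<close>
    also have "\<dots> = vec.representation A' ?u b"
      using vec.representation_extend[OF B(3) uA B(1)] by simp
    also have "\<dots> = 0" using vec.representation_ne_zero[of A' ?u b] b by (auto simp: C_def)
    finally show "(\<Sum>i\<in>t. \<alpha> t i * vec.representation B i b) = 0" .
  qed auto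
  then show ?thesis by (simp add: card_C)
qed

section \<open>Ordinary flats of vector configurations\<close>

text \<open>
  The elements \<open>x\<close> whose point in the contraction of \<open>X\<close> by \<open>A\<close> contains no other element of \<open>X\<close>,
  that is, those for which the flat spanned by \<open>A\<close> and \<open>x\<close> is the direct sum of \<open>x\<close> and the flat of \<open>A\<close>.
\<close>

definition tips :: "(complex ^ 'n) set \<Rightarrow> (complex ^ 'n) set \<Rightarrow> (complex ^ 'n) set" where
  "tips X A = {x \<in> X - vec.span A. X \<inter> vec.span (insert x A) \<subseteq> insert x (vec.span A)}"

lemma span_insert_exchange:
  fixes A :: "(complex ^ 'n) set"
  assumes "x \<in> vec.span (insert y A)" "x \<notin> vec.span A"
  shows "vec.span (insert x A) = vec.span (insert y A)"
proof -
  have "y \<in> vec.span (insert x A)" using assms by (rule vec.in_span_insert)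
  then have "vec.span (insert x A) = vec.span (insert x (insert y A))"
    by (simp only: vec.span_redundant insert_commute[of x y])
  also have "\<dots> = vec.span (insert y A)" using assms(1) by (rule vec.span_redundant)
  finally show ?thesis .
qed

lemma dim_Un_le_card:
  fixes A F :: "(complex ^ 'n) set"
  assumes "finite F"
  shows "vec.dim (A \<union> F) \<le> vec.dim A + card F"
  using assms by (induction F rule: finite_induct) (auto simp: vec.dim_insert)

text \<open>Write \<open>N\<close> and \<open>s\<close> for the two cardinalities in the conclusion,
  and suppose \<open>K * s = (K - j) * N + e\<close> with \<open>e \<ge> 0\<close>. With
  \<open>2 * card Y \<le> N + s\<close> and \<open>K * \<beta> = N + e - j - 1\<close>, the rank
  bound becomes \<open>j * N + (4 * K - j - 2) * e + (4 * K - j) * (4 * K - j - 1) \<le> 0\<close>,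
  where the last summand is positive and the others are nonnegative.\<close>

lemma card_tips_step:
  fixes X A :: "(complex ^ 'n) set" and K j :: nat
  assumes X: "finite X" and A: "A \<subseteq> X" "vec.dim A = j" "j < K" and dimX: "4 * K \<le> vec.dim X"
    and next_le: "\<And>a. a \<in> X - vec.span A \<Longrightarrow>
      real K * card (tips X (insert a A)) \<le> (real K - j - 1) * card (X - vec.span (insert a A))"
  shows "real K * card (tips X A) < (real K - j) * card (X - vec.span A)"
proof (rule ccontr)
  assume contra: "\<not> ?thesis"
  define P where "P = X - vec.span A"
  define S where "S = tips X A"
  \<comment> \<open>One element is chosen for each point of the contraction by \<open>A\<close>. The
    choice depends only on the span, so \<open>Y\<close> contains exactly one element of each
    point.\<close>
  define rep where "rep x = (SOME y. y \<in> P \<and> vec.span (insert y A) = vec.span (insert x A))" for x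
  define Y where "Y = rep ` P"
  have finP: "finite P" using X by (simp add: P_def)
  have rep: "rep x \<in> P" "vec.span (insert (rep x) A) = vec.span (insert x A)" if "x \<in> P" for x
    using someI[of "\<lambda>y. y \<in> P \<and> vec.span (insert y A) = vec.span (insert x A)" x] that
    by (auto simp: rep_def)
  have rep_cong: "rep x = rep y" if "vec.span (insert x A) = vec.span (insert y A)" for x y
    using that by (simp add: rep_def)
  have YP: "Y \<subseteq> P" using rep by (auto simp: Y_def)
  have finY: "finite Y" using finP by (simp add: Y_def)
  have rep_Y: "rep y = y" if y: "y \<in> Y" for y
  proof -
    obtain x where x: "x \<in> P" "y = rep x" using y by (auto simp: Y_def)
    show ?thesis using rep_cong[OF rep(2)[OF x(1)]] x(2) by simp
  qed
  have Y_eq: "x = y" if "x \<in> Y" "y \<in> Y" "vec.span (insert x A) = vec.span (insert y A)" for x y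
    using rep_cong[OF that(3)] rep_Y that by simp
  have nonpar: "x \<notin> vec.span (insert y A)" if "x \<in> Y" "y \<in> Y" "x \<noteq> y" for x y
    using span_insert_exchange[of x y A] Y_eq[of x y] that YP by (auto simp: P_def)
  have S_sub: "x \<in> P" "X \<inter> vec.span (insert x A) \<subseteq> insert x (vec.span A)" if "x \<in> S" for x
    using that by (auto simp: S_def tips_def P_def)
  have SY: "S \<subseteq> Y"
  proof
    fix s assume s: "s \<in> S"
    have "rep s \<in> vec.span (insert s A)"
      using rep(2)[OF S_sub(1)[OF s]] by (metis insertI1 vec.span_base)
    then have "rep s = s" using S_sub[OF s] rep(1)[OF S_sub(1)[OF s]] by (auto simp: P_def)
    then show "s \<in> Y" using S_sub(1)[OF s] by (metis Y_def imageI)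
  qed
  have finS: "finite S" using SY finY finite_subset by blast
  \<comment> \<open>A representative that is not a tip shares its point with an unchosen element.
    The resulting injection of \<open>Y - S\<close> into \<open>P - Y\<close> bounds
    \<open>card Y\<close>.\<close>
  have "\<exists>z. z \<in> P - Y \<and> vec.span (insert z A) = vec.span (insert y A)" if y: "y \<in> Y - S" for y
  proof -
    have "y \<in> P" using y YP by auto
    then obtain z where z: "z \<in> X" "z \<in> vec.span (insert y A)" "z \<noteq> y" "z \<notin> vec.span A"
      using y by (auto simp: S_def tips_def P_def)
    then have "vec.span (insert z A) = vec.span (insert y A)" by (intro span_insert_exchange)
    moreover from this have "z \<notin> Y" using Y_eq[of z y] y z by auto
    ultimately show ?thesis using z by (auto simp: P_def)
  qed
  then obtain g where g: "\<And>y. y \<in> Y - S \<Longrightarrow> g y \<in> P - Y"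
    "\<And>y. y \<in> Y - S \<Longrightarrow> vec.span (insert (g y) A) = vec.span (insert y A)" by metis
  have "card (Y - S) \<le> card (P - Y)"
  proof (rule card_inj_on_le[of g])
    show "inj_on g (Y - S)"
    proof (rule inj_onI)
      fix x y assume xy: "x \<in> Y - S" "y \<in> Y - S" "g x = g y"
      then have "vec.span (insert x A) = vec.span (insert y A)" using g(2)[of x] g(2)[of y] by simp
      then show "x = y" using Y_eq xy by blast
    qed
  qed (use g(1) finP in auto)
  then have two_Y: "2 * card Y \<le> card P + card S"
    using card_Diff_subset[OF finS SY] card_Diff_subset[OF finY YP]
      card_mono[OF finY SY] card_mono[OF finP YP] by linarith
  \<comment> \<open>The element \<open>i\<close> below may itself be a tip, hence
    \<open>card S - 1\<close>. The subtracted quotient bounds the number of tips over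
    \<open>insert i A\<close> by \<open>next_le\<close>, with \<open>card P - 1\<close> because
    \<open>i\<close> leaves the complement.\<close>
  define \<beta> where "\<beta> = real (card S) - 1 - (real K - j - 1) * (real (card P) - 1) / K"
  have deg: "\<beta> \<le> card {k \<in> Y - {i}. \<exists>l\<in>Y - {i, k}. l \<in> vec.span (insert i (insert k A))}"
    if i: "i \<in> Y" for i
  proof -
    have iP: "i \<in> P" using i YP by auto
    let ?R = "tips X (insert i A)"
    have finR: "finite ?R" using X by (auto simp: tips_def)
    \<comment> \<open>As \<open>k\<close> is no tip over \<open>insert i A\<close>, some
      \<open>z \<noteq> k\<close> lies in the span of \<open>A\<close>, \<open>i\<close>,
      \<open>k\<close> but not in that of \<open>A\<close>, \<open>i\<close>. Its representative is
      a third point on the line: it is not \<open>i\<close> by the choice of \<open>z\<close>, and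
      not \<open>k\<close> because a tip over \<open>A\<close> is alone in its point.\<close>
    have "(S - {i}) - ?R \<subseteq> {k \<in> Y - {i}. \<exists>l\<in>Y - {i, k}. l \<in> vec.span (insert i (insert k A))}"
    proof
      fix k assume k: "k \<in> (S - {i}) - ?R"
      then have kY: "k \<in> Y" "k \<noteq> i" "k \<in> S" using SY by auto
      have kX: "k \<in> X" using kY(1) YP by (auto simp: P_def)
      have "k \<notin> vec.span (insert i A)" using nonpar kY i by auto
      then obtain z where z: "z \<in> X" "z \<in> vec.span (insert k (insert i A))" "z \<noteq> k" "z \<notin> vec.span (insert i A)"
        using k kX by (auto simp: tips_def)
      have zA: "z \<notin> vec.span A" using z(4) vec.span_mono[of A "insert i A"] by auto
      then have zP: "z \<in> P" using z by (simp add: P_def)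
      have l: "rep z \<in> Y" using zP by (simp add: Y_def)
      have z_in: "z \<in> vec.span (insert (rep z) A)" using rep(2)[OF zP] by (metis insertI1 vec.span_base)
      have "rep z \<in> vec.span (insert z A)" using rep(2)[OF zP] by (metis insertI1 vec.span_base)
      also have "vec.span (insert z A) \<subseteq> vec.span (insert i (insert k A))"
        using z(2) by (intro vec.span_minimal) (auto simp: insert_commute intro: vec.span_base)
      finally have "rep z \<in> vec.span (insert i (insert k A))" .
      moreover have "rep z \<noteq> i" using z_in z(4) by auto
      moreover have "rep z \<noteq> k" using z_in S_sub(2)[OF kY(3)] z zA by auto
      ultimately show "k \<in> {k \<in> Y - {i}. \<exists>l\<in>Y - {i, k}. l \<in> vec.span (insert i (insert k A))}"
        using kY l by auto
    qed
    then have "card ((S - {i}) - ?R) \<le> card {k \<in> Y - {i}. \<exists>l\<in>Y - {i, k}. l \<in> vec.span (insert i (insert k A))}"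
      using finY by (intro card_mono) auto
    moreover have "card (S - {i}) - card ?R \<le> card ((S - {i}) - ?R)"
      using finR by (rule diff_card_le_card_Diff)
    moreover have "card S - 1 \<le> card (S - {i})" by (metis card_Diff_singleton_if diff_le_self le_refl)
    moreover have "real (card ?R) \<le> (real K - j - 1) * (real (card P) - 1) / K"
    proof -
      have "X - vec.span (insert i A) \<subseteq> P - {i}"
        using vec.span_mono[of A "insert i A"] vec.span_base[of i "insert i A"] by (auto simp: P_def)
      then have "card (X - vec.span (insert i A)) \<le> card (P - {i})" using finP by (intro card_mono) auto
      also have "\<dots> = card P - 1" using iP by simp
      finally have "real (card (X - vec.span (insert i A))) \<le> real (card P) - 1"
        using card_gt_0_iff[of P] iP finP by (auto simp: of_nat_diff)
      then have "(real K - j - 1) * card (X - vec.span (insert i A)) \<le> (real K - j - 1) * (real (card P) - 1)"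
        using A(3) by (intro mult_left_mono) auto
      with next_le[of i] iP have "real K * card ?R \<le> (real K - j - 1) * (real (card P) - 1)"
        by (auto simp: P_def)
      then show ?thesis using A(3) by (simp add: pos_le_divide_eq mult.commute)
    qed
    ultimately show ?thesis unfolding \<beta>_def by linarith
  qed
  have "X \<subseteq> vec.span (A \<union> Y)"
  proof
    fix x assume x: "x \<in> X"
    show "x \<in> vec.span (A \<union> Y)"
    proof (cases "x \<in> vec.span A")
      case True
      then show ?thesis using vec.span_mono[of A "A \<union> Y"] by auto
    next
      case False
      then have xP: "x \<in> P" using x by (simp add: P_def)
      have "x \<in> vec.span (insert (rep x) A)" using rep(2)[OF xP] by (metis insertI1 vec.span_base)
      then show ?thesis using vec.span_mono[of "insert (rep x) A" "A \<union> Y"] xP by (auto simp: Y_def)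
    qed
  qed
  then have dim_le: "vec.dim X \<le> vec.dim (A \<union> Y)" by (rule vec.dim_mono)
  \<comment> \<open>This crude count serves to make \<open>\<beta>\<close> positive, as the rank
    bound requires: it yields \<open>K * \<beta> \<ge> 4 * K - 2 * j - 1\<close>.\<close>
  have "vec.dim (A \<union> Y) \<le> j + card Y" using dim_Un_le_card[OF finY, of A] A by simp
  then have "4 * K \<le> j + card P" using dim_le dimX card_mono[OF finP YP] by linarith
  then have P_large: "4 * real K \<le> j + real (card P)" by linarith
  have jK: "real j + 1 \<le> K" using A(3) by simp
  have K0: "real K > 0" using A(3) by simp
  define e where "e = real K * card S - (real K - j) * card P"
  have e: "e \<ge> 0" "real K * card S = (real K - j) * card P + e"
    using contra by (simp_all add: e_def P_def S_def)
  have K\<beta>: "K * \<beta> = card P + e - j - 1"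
  proof -
    have "K * \<beta> = real K * card S - K - (real K - j - 1) * (real (card P) - 1)"
      using K0 by (simp add: \<beta>_def field_simps)
    then show ?thesis using e(2) by (simp add: algebra_simps)
  qed
  have "K * \<beta> > 0" using K\<beta> e(1) P_large jK by linarith
  then have \<beta>: "\<beta> > 0" using K0 by (simp add: zero_less_mult_iff)
  have "(real (vec.dim (A \<union> Y)) - vec.dim A) * (\<beta> + 4) \<le> 4 * card Y"
    by (rule collinear_triples_rank_bound[OF finY nonpar deg \<beta>])
  moreover have "(4 * real K - j) * (\<beta> + 4) \<le> (real (vec.dim (A \<union> Y)) - vec.dim A) * (\<beta> + 4)"
    using dim_le dimX A(2) \<beta> by (intro mult_right_mono) auto
  moreover have "4 * real (card Y) \<le> 2 * (real (card P) + card S)"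
    using of_nat_mono[OF two_Y, where 'a = real] by simp
  ultimately have "(4 * real K - j) * (\<beta> + 4) \<le> 2 * (real (card P) + card S)" by linarith
  then have "real K * ((4 * real K - j) * (\<beta> + 4)) \<le> real K * (2 * (real (card P) + card S))"
    using K0 by (intro mult_left_mono) auto
  moreover have "real K * ((4 * real K - j) * (\<beta> + 4)) = (4 * real K - j) * (K * \<beta> + 4 * K)"
    by (simp add: algebra_simps)
  moreover have "real K * (2 * (real (card P) + card S)) = 2 * (real K * card P) + 2 * (real K * card S)"
    by (simp add: algebra_simps)
  ultimately have "(4 * real K - j) * (card P + e + (4 * real K - j - 1)) \<le>
      2 * (real K * card P) + 2 * ((real K - j) * card P + e)"
    unfolding K\<beta> e(2) by (simp add: algebra_simps)
  then have "real j * card P + (4 * real K - j - 2) * e + (4 * real K - j) * (4 * real K - j - 1) \<le> 0"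
    by (simp add: algebra_simps)
  moreover have "real j * card P \<ge> 0" by simp
  moreover have "(4 * real K - j - 2) * e \<ge> 0" using e(1) jK by (intro mult_nonneg_nonneg) auto
  moreover have "(4 * real K - j) * (4 * real K - j - 1) > 0" using jK by (intro mult_pos_pos) auto
  ultimately show False by linarith
qed

theorem exists_vector_configuration_ordinary_flat:
  fixes X :: "(complex ^ 'n) set"
  assumes X: "finite X" "0 \<notin> X"
    and nonpar: "\<And>x y. x \<in> X \<Longrightarrow> y \<in> X \<Longrightarrow> x \<noteq> y \<Longrightarrow> x \<notin> vec.span {y}"
    and K: "K \<ge> 1" "4 * K \<le> vec.dim X"
  shows "\<exists>A p. A \<subseteq> X \<and> vec.dim A = K \<and> p \<in> X - vec.span A \<and>
    X \<inter> vec.span (insert p A) \<subseteq> insert p (vec.span A)"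
proof (rule ccontr)
  assume "\<not> ?thesis"
  then have none: "tips X A = {}" if "A \<subseteq> X" "vec.dim A = K" for A
    using that unfolding tips_def by blast
  have dim_next: "vec.dim (insert a A) = Suc (vec.dim A)" if "a \<in> X - vec.span A" for a A
    using that by (simp add: vec.dim_insert)
  \<comment> \<open>Induction on the corank \<open>m\<close> of \<open>A\<close> below
    \<open>K\<close>; at \<open>m = 0\<close> there are no tips by \<open>none\<close>.\<close>
  have main: "real K * card (tips X A) \<le> real m * card (X - vec.span A)"
    if "A \<subseteq> X" "vec.dim A + m = K" for A m
    using that
  proof (induction m arbitrary: A)
    case 0
    then show ?case using none by simp
  next
    case (Suc m)
    have "real K * card (tips X A) < (real K - vec.dim A) * card (X - vec.span A)"
    proof (rule card_tips_step[OF X(1) Suc.prems(1) refl _ K(2)])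
      fix a assume a: "a \<in> X - vec.span A"
      have "real K - vec.dim A - 1 = m" using Suc.prems(2) by linarith
      moreover have "real K * card (tips X (insert a A)) \<le> real m * card (X - vec.span (insert a A))"
        using Suc.IH[of "insert a A"] dim_next[OF a] Suc.prems a by simp
      ultimately show "real K * card (tips X (insert a A)) \<le> (real K - vec.dim A - 1) * card (X - vec.span (insert a A))"
        by (simp only:)
    qed (use Suc.prems in simp)
    moreover have "real K - vec.dim A = Suc m" using Suc.prems(2) by linarith
    ultimately show ?case by simp
  qed
  \<comment> \<open>For \<open>A = {}\<close> every element is a tip, so \<open>main\<close> would
    only give an equality. The step is applied once more directly for its strict inequality.\<close>
  have "real K * card (tips X {}) < (real K - 0) * card (X - vec.span {})"
  proof (rule card_tips_step[OF X(1), of "{}" 0 K, unfolded of_nat_0])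
    fix a assume a: "a \<in> X - vec.span {}"
    then show "real K * card (tips X {a}) \<le> (real K - 0 - 1) * card (X - vec.span {a})"
      using main[of "{a}" "K - 1"] K by (auto simp: of_nat_diff)
  qed (use K in auto)
  moreover have "tips X {} = X"
    using X(2) nonpar by (auto simp: tips_def)
  moreover have "X - vec.span {} = X" using X(2) by auto
  ultimately show False by simp
qed

section \<open>Represented matroids\<close>

text \<open>A basis chosen among the vectors of \<open>F\<close> lifts to an independent set by
  picking one preimage of each basis vector, which makes \<open>v\<close> injective on the
  lift.\<close>

lemma matroid_rank_complex_indep:
  fixes v :: "'a \<Rightarrow> complex ^ 'n"
  assumes "finite E" "F \<subseteq> E"
  shows "matroid_rank (complex_indep E v) F = vec.dim (v ` F)"
  unfolding matroid_rank_def
proof (rule Max_eqI)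
  have "{card I |I. I \<subseteq> F \<and> complex_indep E v I} \<subseteq> card ` Pow F" by auto
  moreover have "finite F" using assms finite_subset by blast
  ultimately show "finite {card I |I. I \<subseteq> F \<and> complex_indep E v I}"
    by (auto intro: finite_subset)
next
  fix m assume "m \<in> {card I |I. I \<subseteq> F \<and> complex_indep E v I}"
  then obtain I where I: "I \<subseteq> F" "inj_on v I" "vec.independent (v ` I)" "m = card I"
    by (auto simp: complex_indep_def)
  have "m = card (v ` I)" using I by (simp add: card_image)
  also have "\<dots> \<le> vec.dim (v ` F)" using I by (intro vec.independent_card_le_dim) auto
  finally show "m \<le> vec.dim (v ` F)" .
next
  obtain B where B: "B \<subseteq> v ` F" "vec.independent B" "card B = vec.dim (v ` F)"
    using vec.basis_exists[of "v ` F"] by metis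
  then obtain I where "I \<subseteq> F" "inj_on v I" "B = v ` I" by (meson subset_image_inj)
  moreover from this have "card I = vec.dim (v ` F)" using B by (simp add: card_image)
  ultimately show "vec.dim (v ` F) \<in> {card I |I. I \<subseteq> F \<and> complex_indep E v I}"
    using B assms by (auto simp: complex_indep_def intro!: exI[of _ I])
qed

text \<open>A larger set of the same rank has an image spanning the same subspace, so it already
  lies in the preimage.\<close>

lemma rank_flat_span_preimage:
  fixes v :: "'a \<Rightarrow> complex ^ 'n"
  assumes E: "finite E" and S: "S \<subseteq> v ` E"
  shows "rank_flat E (complex_indep E v) (vec.dim S) {x \<in> E. v x \<in> vec.span S}"
proof -
  let ?F = "{x \<in> E. v x \<in> vec.span S}"
  have "S \<subseteq> v ` ?F" using S vec.span_superset[of S] by auto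
  then have span: "vec.span (v ` ?F) = vec.span S"
    by (intro subset_antisym vec.span_minimal vec.span_mono) auto
  then have dimF: "vec.dim (v ` ?F) = vec.dim S" by (metis vec.dim_span)
  show ?thesis
    unfolding rank_flat_def
  proof (intro conjI allI impI)
    show "matroid_rank (complex_indep E v) ?F = vec.dim S"
      using dimF by (simp add: matroid_rank_complex_indep[OF E])
  next
    fix G assume G: "?F \<subseteq> G \<and> G \<subseteq> E \<and> matroid_rank (complex_indep E v) G = vec.dim S"
    then have "vec.dim (v ` G) = vec.dim (v ` ?F)"
      using dimF matroid_rank_complex_indep[OF E, of G v] by simp
    then have "vec.span (v ` ?F) = vec.span (v ` G)"
      using G by (intro vec.dim_eq_span) auto
    then have "v x \<in> vec.span S" if "x \<in> G" for x
      using that span by (metis imageI vec.span_base)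
    then show "G = ?F" using G by auto
  qed auto
qed

text \<open>This removes loops and parallel elements: nonzero vectors are classed by the line they
  span, and one is chosen from each class.\<close>

lemma exists_point_representatives:
  fixes V :: "(complex ^ 'n) set"
  shows "\<exists>X \<subseteq> V. 0 \<notin> X \<and> (\<forall>x\<in>X. \<forall>y\<in>X. x \<noteq> y \<longrightarrow> x \<notin> vec.span {y}) \<and>
    (\<forall>u\<in>V - {0}. \<exists>x\<in>X. vec.span {x} = vec.span {u})"
proof -
  define rep where "rep u = (SOME z. z \<in> V - {0} \<and> vec.span {z} = vec.span {u})" for u
  have rep: "rep u \<in> V - {0}" "vec.span {rep u} = vec.span {u}" if "u \<in> V - {0}" for u
    using someI[of "\<lambda>z. z \<in> V - {0} \<and> vec.span {z} = vec.span {u}" u] that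
    by (auto simp: rep_def)
  have rep_cong: "rep x = rep y" if "vec.span {x} = vec.span {y}" for x y
    using that by (simp add: rep_def)
  have "x \<notin> vec.span {y}" if xy: "x \<in> rep ` (V - {0})" "y \<in> rep ` (V - {0})" "x \<noteq> y" for x y
  proof
    assume "x \<in> vec.span {y}"
    moreover obtain u z where uz: "u \<in> V - {0}" "z \<in> V - {0}" "x = rep u" "y = rep z" using xy by blast
    moreover have "x \<noteq> 0" using rep(1)[OF uz(1)] uz(3) by auto
    ultimately have "vec.span {x} = vec.span {y}" using span_insert_exchange[of x y "{}"] by simp
    then have "vec.span {u} = vec.span {z}" using rep(2)[OF uz(1)] rep(2)[OF uz(2)] uz(3,4) by simp
    then show False using rep_cong xy(3) uz(3,4) by blast
  qed
  moreover have "rep ` (V - {0}) \<subseteq> V" "0 \<notin> rep ` (V - {0})" using rep(1) by fastforce+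
  moreover have "\<forall>u\<in>V - {0}. \<exists>x\<in>rep ` (V - {0}). vec.span {x} = vec.span {u}" using rep(2) by blast
  ultimately show ?thesis by (intro exI[of _ "rep ` (V - {0})"]) blast
qed

theorem mainTheorem1:
  fixes k :: nat and E :: "'a set" and v :: "'a \<Rightarrow> complex ^ 'n"
  assumes "k \<ge> 2"
    and "finite E"
    and "matroid_rank (complex_indep E v) E \<ge> 4 * (k - 1)"
  shows "\<exists>F. ordinary_flat E (complex_indep E v) k F"
proof -
  note E = assms(2)
  from exists_point_representatives[of "v ` E"] obtain X where X: "X \<subseteq> v ` E" "0 \<notin> X"
    and nonpar_all: "\<forall>x\<in>X. \<forall>y\<in>X. x \<noteq> y \<longrightarrow> x \<notin> vec.span {y}"
    and cover_all: "\<forall>u\<in>v ` E - {0}. \<exists>x\<in>X. vec.span {x} = vec.span {u}"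
    by (elim exE conjE)
  have nonpar: "x \<notin> vec.span {y}" if "x \<in> X" "y \<in> X" "x \<noteq> y" for x y
    using nonpar_all that by simp
  have cover: "\<exists>x\<in>X. vec.span {x} = vec.span {u}" if "u \<in> v ` E - {0}" for u
    using cover_all that by (rule bspec)
  have finX: "finite X" using X(1) E finite_subset by blast
  have "v ` E \<subseteq> vec.span X"
  proof
    fix u assume u: "u \<in> v ` E"
    show "u \<in> vec.span X"
    proof (cases "u = 0")
      case False
      then obtain x where x: "x \<in> X" "vec.span {x} = vec.span {u}" using cover u by blast
      have "u \<in> vec.span {x}" using x(2) vec.span_base[of u "{u}"] by simp
      then show ?thesis using vec.span_mono[of "{x}" X] x(1) by auto
    qed (simp add: vec.span_zero)
  qed
  then have "4 * (k - 1) \<le> vec.dim X"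
    using vec.dim_mono[of "v ` E" X] assms(3) matroid_rank_complex_indep[OF E subset_refl, of v] by linarith
  moreover have "k - 1 \<ge> 1" using assms(1) by simp
  ultimately obtain A p where A: "A \<subseteq> X" "vec.dim A = k - 1" and p: "p \<in> X" "p \<notin> vec.span A"
    and ord: "X \<inter> vec.span (insert p A) \<subseteq> insert p (vec.span A)"
    using exists_vector_configuration_ordinary_flat[OF finX X(2) nonpar, of "k - 1"] by blast
  \<comment> \<open>Taking preimages in \<open>E\<close> brings back the loops and parallel elements
    left out of \<open>X\<close>.\<close>
  define F P H where "F = {x \<in> E. v x \<in> vec.span (insert p A)}"
    and "P = {x \<in> E. v x \<in> vec.span {p}}" and "H = {x \<in> E. v x \<in> vec.span A}"
  have dimF: "vec.dim (insert p A) = k" using A(2) p(2) assms(1) by (simp add: vec.dim_insert)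
  have dimP: "vec.dim {p} = 1" using p X by auto
  have F: "rank_flat E (complex_indep E v) k F"
    using rank_flat_span_preimage[OF E, of "insert p A" v] A p X dimF by (auto simp: F_def)
  have P: "rank_flat E (complex_indep E v) 1 P"
    using rank_flat_span_preimage[OF E, of "{p}" v] p X dimP by (auto simp: P_def)
  have H: "rank_flat E (complex_indep E v) (k - 1) H"
    using rank_flat_span_preimage[OF E, of A v] A X by (auto simp: H_def)
  \<comment> \<open>Loops lie in every flat. Otherwise \<open>v x\<close> is parallel to some
    \<open>z \<in> X\<close> in the span of \<open>p\<close> and \<open>A\<close>, and
    \<open>ord\<close> forces \<open>z = p\<close> or \<open>z\<close> in the span of
    \<open>A\<close>.\<close>
  have "F \<subseteq> P \<union> H"
  proof
    fix x assume x: "x \<in> F"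
    show "x \<in> P \<union> H"
    proof (cases "v x = 0")
      case True
      then show ?thesis using x by (simp add: F_def P_def vec.span_zero)
    next
      case False
      then obtain z where z: "z \<in> X" "vec.span {z} = vec.span {v x}"
        using cover[of "v x"] x by (auto simp: F_def)
      have "z \<in> vec.span {v x}" using z(2) vec.span_base[of z "{z}"] by simp
      also have "\<dots> \<subseteq> vec.span (insert p A)"
        using x by (intro vec.span_minimal) (auto simp: F_def)
      finally have "z = p \<or> z \<in> vec.span A" using ord z(1) by auto
      moreover have vx: "v x \<in> vec.span {z}" using z(2) vec.span_base[of "v x" "{v x}"] by simp
      moreover have "vec.span {z} \<subseteq> vec.span A" if "z \<in> vec.span A"
        using that by (intro vec.span_minimal) auto
      ultimately show ?thesis using x by (auto simp: F_def P_def H_def)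
    qed
  qed
  moreover have "P \<union> H \<subseteq> F"
    using vec.span_mono[of "{p}" "insert p A"] vec.span_mono[of A "insert p A"]
    by (auto simp: F_def P_def H_def)
  ultimately have "F = P \<union> H" by blast
  moreover have "matroid_rank (complex_indep E v) F =
      matroid_rank (complex_indep E v) P + matroid_rank (complex_indep E v) H"
    using F P H assms(1) by (simp add: rank_flat_def)
  ultimately have "flat_direct_sum (complex_indep E v) F P H"
    by (simp add: flat_direct_sum_def)
  then have "ordinary_flat E (complex_indep E v) k F"
    using F P H unfolding ordinary_flat_def matroid_point_def by blast
  then show ?thesis by blast
qed

end
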